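(* Let $q\in[2,3]$, let $f,g$ satisfy Assumption (A1), and let $\{x^k\}_{k\in\mathbb{N}}$ be the iterate sequence generated by Algorithm (Alg) such that Assumption (A2) holds (all stated in the context). Suppose that $F=f+g$ is a KL function. Then $\sum_{k=0}^{\infty}\|x^{k+1}-x^k\|<\infty$, and consequently $\{x^k\}_{k\in\mathbb{N}}$ converges to a point $\overline{x}\in\mathcal{S}^*$.
   Context: $\mathbb{X}$ is a finite-dimensional real vector space with inner product $\langle\cdot,\cdot\rangle$ and induced norm $\|\cdot\|$; $\overline{\mathbb{R}}=(-\infty,\infty]$; $f,g:\mathbb{X}\to\overline{\mathbb{R}}$, $F:=f+g$. Assumption (A1): $f$ is proper lower semicontinuous (lsc) and twice continuously differentiable on an open set $\mathcal{O}\supset\mathrm{cl}(\mathrm{dom}\,g)$; $g$ is proper, lsc, convex with $\mathrm{dom}\,g\neq\emptyset$; $F$ is bounded below. $\partial$ denotes the limiting (Mordukhovich) subdifferential. $\mathcal{S}^*:=\{x\in\mathbb{X}: 0\in\partial F(x)\}$ is the set of stationary points. $\mathrm{prox}_g(x):=\arg\min_z\{\frac12\|z-x\|^2+g(z)\}$. Algorithm (Alg). Input: $q\in[2,3]$, $0<L_m<L_M$, $\varrho\in(0,1)$, $\sigma\in(0,1)$, $\tau>1$, $x^0\in\mathrm{dom}\,g$. For $k=0,1,2,\dots$, with $\vartheta_k(x):=f(x^k)+\langle\nabla f(x^k),x-x^k\rangle+\frac12\langle\nabla^2f(x^k)(x-x^k),x-x^k\rangle$: 1. Choose $L_{k,0}\in[L_m,L_M]$,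 with in addition $L_{k,0}>\max(0,-\lambda_{\min}(\nabla^2f(x^k)))$ if $q=2$. 2. For $j=0,1,2,\dots$: let $f_{k,j}(x):=\vartheta_k(x)+\frac{L_{k,j}}{q}\|x-x^k\|^q$, $\Theta_{k,j}:=f_{k,j}+g$, $R_{k,j}(x):=x-\mathrm{prox}_g(x-\nabla f_{k,j}(x))$, $r_{k,j}(x):=\|R_{k,j}(x)\|$. Compute $y^{k,j}$ with $r_{k,j}(y^{k,j})\le\varrho L_{k,j}\|y^{k,j}-x^k\|^{q-1}$ and $\Theta_{k,j}(y^{k,j})\le\Theta_{k,j}(x^k)$. If $F(y^{k,j})\le F(x^k)-\frac{\sigma L_{k,j}}{q}\|y^{k,j}-x^k\|^q$, set $j_k:=j$ and go to step 3; otherwise set $L_{k,j+1}:=\tau L_{k,j}$ and continue with $j+1$. 3. Set $L_k:=L_{k,j_k}$, $y^k:=y^{k,j_k}$, $v^k:=R_{k,j_k}(y^k)$, and $x^{k+1}:=y^k$ if $F(y^k)<F(y^k-v^k)$, $x^{k+1}:=y^k-v^k$ otherwise. $\omega(x^0)$ denotes the set of accumulation points of $\{x^k\}$. Assumption (A2): (i) $\{x^k\}_{k\in\mathbb{N}}$ is bounded; (ii) $\nabla^2f$ is strictly continuous (i.e. Lipschitz continuous on a neighborhood of each point) on an open convex set $\mathcal{N}$ with $\mathcal{O}\supset\mathcal{N}\supset\omega(x^0)$. KL function: for $\varpi>0$ let $\Upsilon_\varpi$ be the set of continuous concave $\varphi:[0,\varpi)\to\mathbb{R}_+$ that are continuously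 differentiable on $(0,\varpi)$ with $\varphi(0)=0$ and $\varphi'>0$ on $(0,\varpi)$. A proper $h:\mathbb{X}\to\overline{\mathbb{R}}$ has the KL property at $\overline{x}\in\mathrm{dom}\,\partial h$ if there are $\delta>0$, $\varpi\in(0,\infty]$, $\varphi\in\Upsilon_\varpi$ with $\varphi'(h(x)-h(\overline{x}))\,\mathrm{dist}(0,\partial h(x))\ge1$ for all $x$ with $\|x-\overline{x}\|\le\delta$ and $h(\overline{x})<h(x)<h(\overline{x})+\varpi$. $h$ is a KL function if it has the KL property at every point of $\mathrm{dom}\,\partial h$. *)

theory Defs
  imports "HOL-Analysis.Analysis"
begin

section \<open>Extended-real-valued functions\<close>

text \<open>Functions into \<open>(-\<infinity>, \<infinity>]\<close> are of type \<open>'a \<Rightarrow> ereal\<close>; the value \<open>-\<infinity>\<close> is excluded by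
  \<open>proper\<close>.\<close>

definition edom :: "('a \<Rightarrow> ereal) \<Rightarrow> 'a set" where
  "edom h = {x. h x < \<infinity>}"

definition proper :: "('a \<Rightarrow> ereal) \<Rightarrow> bool" where
  "proper h \<longleftrightarrow> (\<forall>x. h x \<noteq> -\<infinity>) \<and> edom h \<noteq> {}"

definition lsc :: "('a::topological_space \<Rightarrow> ereal) \<Rightarrow> bool" where
  "lsc h \<longleftrightarrow> (\<forall>x. h x \<le> Liminf (at x) h)"

definition econvex :: "('a::real_vector \<Rightarrow> ereal) \<Rightarrow> bool" where
  "econvex h \<longleftrightarrow> (\<forall>x y. \<forall>t\<in>{0<..<1}.
     h ((1 - t) *\<^sub>R x + t *\<^sub>R y) \<le> ereal (1 - t) * h x + ereal t * h y)"

section \<open>Gradient, Hessian, second-order smoothness\<close>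

definition grad :: "('a::euclidean_space \<Rightarrow> real) \<Rightarrow> 'a \<Rightarrow> 'a" where
  "grad p x = (THE D. GDERIV p x :> D)"

text \<open>The Hessian is a bounded linear operator, so that its continuity and Lipschitz continuity
  refer to the operator norm.\<close>

definition hess :: "('a::euclidean_space \<Rightarrow> real) \<Rightarrow> 'a \<Rightarrow> 'a \<Rightarrow>\<^sub>L 'a" where
  "hess p x = Blinfun (frechet_derivative (grad p) (at x))"

definition C2_on :: "'a::euclidean_space set \<Rightarrow> ('a \<Rightarrow> real) \<Rightarrow> bool" where
  "C2_on U p \<longleftrightarrow> (\<forall>x\<in>U. p differentiable at x) \<and> (\<forall>x\<in>U. grad p differentiable at x) \<and>
     continuous_on U (hess p)"

definition eC2_on :: "'a::euclidean_space set \<Rightarrow> ('a \<Rightarrow> ereal) \<Rightarrow> bool" where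
  "eC2_on U h \<longleftrightarrow> (\<forall>x\<in>U. \<bar>h x\<bar> \<noteq> \<infinity>) \<and> C2_on U (\<lambda>x. real_of_ereal (h x))"

definition lambda_min :: "('a::euclidean_space \<Rightarrow>\<^sub>L 'a) \<Rightarrow> real" where
  "lambda_min A = Min {c. \<exists>v. v \<noteq> 0 \<and> blinfun_apply A v = c *\<^sub>R v}"

definition strictly_continuous_on ::
    "'a::metric_space set \<Rightarrow> ('a \<Rightarrow> 'b::metric_space) \<Rightarrow> bool" where
  "strictly_continuous_on U p \<longleftrightarrow>
     (\<forall>z\<in>U. \<exists>e>0. \<exists>K. K-lipschitz_on (ball z e \<inter> U) p)"

section \<open>Limiting subdifferential and stationary points\<close>

definition regular_subdiff :: "('a::euclidean_space \<Rightarrow> ereal) \<Rightarrow> 'a \<Rightarrow> 'a set" where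
  "regular_subdiff h x = {v. \<bar>h x\<bar> \<noteq> \<infinity> \<and>
     0 \<le> Liminf (at x) (\<lambda>z. (h z - h x - ereal (v \<bullet> (z - x))) / ereal (norm (z - x)))}"

definition limiting_subdiff :: "('a::euclidean_space \<Rightarrow> ereal) \<Rightarrow> 'a \<Rightarrow> 'a set" where
  "limiting_subdiff h x = {v. \<bar>h x\<bar> \<noteq> \<infinity> \<and>
     (\<exists>u w. u \<longlonglongrightarrow> x \<and> (\<lambda>n. h (u n)) \<longlonglongrightarrow> h x \<and>
            (\<forall>n. w n \<in> regular_subdiff h (u n)) \<and> w \<longlonglongrightarrow> v)}"

definition stationary :: "('a::euclidean_space \<Rightarrow> ereal) \<Rightarrow> 'a set" where
  "stationary h = {x. 0 \<in> limiting_subdiff h x}"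

section \<open>Kurdyka-Lojasiewicz functions\<close>

definition KL_desing :: "ereal \<Rightarrow> (real \<Rightarrow> real) set" where
  "KL_desing w = {p.
     continuous_on {t. 0 \<le> t \<and> ereal t < w} p \<and>
     concave_on {t. 0 \<le> t \<and> ereal t < w} p \<and>
     (\<forall>t. 0 \<le> t \<and> ereal t < w \<longrightarrow> 0 \<le> p t) \<and>
     p 0 = 0 \<and>
     (\<forall>t. 0 < t \<and> ereal t < w \<longrightarrow> p differentiable at t) \<and>
     continuous_on {t. 0 < t \<and> ereal t < w} (deriv p) \<and>
     (\<forall>t. 0 < t \<and> ereal t < w \<longrightarrow> 0 < deriv p t)}"

text \<open>Distance to a set with the convention that the distance to the empty set is \<open>\<infinity>\<close>
  (the library's \<open>infdist\<close> returns \<open>0\<close> there).\<close>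

definition edist_to :: "'a::metric_space \<Rightarrow> 'a set \<Rightarrow> ereal" where
  "edist_to x S = (INF y\<in>S. ereal (dist x y))"

definition KL_at :: "('a::euclidean_space \<Rightarrow> ereal) \<Rightarrow> 'a \<Rightarrow> bool" where
  "KL_at h xb \<longleftrightarrow> (\<exists>\<delta>>0. \<exists>w::ereal. 0 < w \<and> (\<exists>p\<in>KL_desing w.
     \<forall>x. norm (x - xb) \<le> \<delta> \<and> h xb < h x \<and> h x < h xb + w \<longrightarrow>
       1 \<le> ereal (deriv p (real_of_ereal (h x - h xb))) * edist_to 0 (limiting_subdiff h x)))"

definition KL_function :: "('a::euclidean_space \<Rightarrow> ereal) \<Rightarrow> bool" where
  "KL_function h \<longleftrightarrow> proper h \<and> (\<forall>xb. limiting_subdiff h xb \<noteq> {} \<longrightarrow> KL_at h xb)"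

section \<open>The algorithm\<close>

text \<open>The minimizer is unique when \<open>g\<close> is proper, lsc and convex.\<close>

definition prox :: "('a::euclidean_space \<Rightarrow> ereal) \<Rightarrow> 'a \<Rightarrow> 'a" where
  "prox g x = (ARG_MIN (\<lambda>z. ereal (1 / 2 * (norm (z - x))\<^sup>2) + g z) z. True)"

definition taylor2 :: "('a::euclidean_space \<Rightarrow> real) \<Rightarrow> 'a \<Rightarrow> 'a \<Rightarrow> real" where
  "taylor2 p xk x = p xk + grad p xk \<bullet> (x - xk) +
     1 / 2 * (blinfun_apply (hess p xk) (x - xk) \<bullet> (x - xk))"

text \<open>The argument \<open>M\<close> below is a trial value \<open>L\<^bsub>k,j\<^esub>\<close>.\<close>

definition reg_model :: "('a::euclidean_space \<Rightarrow> real) \<Rightarrow> real \<Rightarrow> 'a \<Rightarrow> real \<Rightarrow> 'a \<Rightarrow> real" where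
  "reg_model p q xk M x = taylor2 p xk x + M / q * norm (x - xk) powr q"

definition residual ::
    "('a::euclidean_space \<Rightarrow> real) \<Rightarrow> ('a \<Rightarrow> ereal) \<Rightarrow> real \<Rightarrow> 'a \<Rightarrow> real \<Rightarrow> 'a \<Rightarrow> 'a" where
  "residual p g q xk M x = x - prox g (x - grad (reg_model p q xk M) x)"

definition inexact_sol ::
    "('a::euclidean_space \<Rightarrow> real) \<Rightarrow> ('a \<Rightarrow> ereal) \<Rightarrow> real \<Rightarrow> real \<Rightarrow> 'a \<Rightarrow> real \<Rightarrow> 'a \<Rightarrow> bool" where
  "inexact_sol p g q \<rho> xk M y \<longleftrightarrow>
     norm (residual p g q xk M y) \<le> \<rho> * M * norm (y - xk) powr (q - 1) \<and>
     ereal (reg_model p q xk M y) + g y \<le> ereal (reg_model p q xk M xk) + g xk"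

definition sufficient_decrease ::
    "('a::euclidean_space \<Rightarrow> ereal) \<Rightarrow> real \<Rightarrow> real \<Rightarrow> 'a \<Rightarrow> real \<Rightarrow> 'a \<Rightarrow> bool" where
  "sufficient_decrease F q \<sigma> xk M y \<longleftrightarrow>
     F y \<le> F xk - ereal (\<sigma> * M / q * norm (y - xk) powr q)"

text \<open>A run of the algorithm: \<open>x k\<close> is the outer iterate, \<open>L k j\<close> and \<open>y k j\<close> are the inner
  trial values and trial points, and \<open>J k\<close> is the inner index at which the line search stops.
  Only the entries with \<open>j \<le> J k\<close> are constrained. The trial points are not determined
  uniquely, hence a relation rather than a function.\<close>

definition algorithm_run ::
    "('a::euclidean_space \<Rightarrow> ereal) \<Rightarrow> ('a \<Rightarrow> ereal) \<Rightarrow>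
     real \<Rightarrow> real \<Rightarrow> real \<Rightarrow> real \<Rightarrow> real \<Rightarrow> real \<Rightarrow>
     (nat \<Rightarrow> 'a) \<Rightarrow> (nat \<Rightarrow> nat \<Rightarrow> real) \<Rightarrow> (nat \<Rightarrow> nat \<Rightarrow> 'a) \<Rightarrow> (nat \<Rightarrow> nat) \<Rightarrow> bool" where
  "algorithm_run f g q Lm LM \<rho> \<sigma> \<tau> x L y J \<longleftrightarrow>
    (let F = (\<lambda>u. f u + g u); p = (\<lambda>u. real_of_ereal (f u)) in
     x 0 \<in> edom g \<and>
     (\<forall>k.
       L k 0 \<in> {Lm..LM} \<and>
       (q = 2 \<longrightarrow> L k 0 > max 0 (- lambda_min (hess p (x k)))) \<and>
       (\<forall>j\<le>J k. inexact_sol p g q \<rho> (x k) (L k j) (y k j)) \<and>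
       (\<forall>j<J k. \<not> sufficient_decrease F q \<sigma> (x k) (L k j) (y k j) \<and> L k (Suc j) = \<tau> * L k j) \<and>
       sufficient_decrease F q \<sigma> (x k) (L k (J k)) (y k (J k)) \<and>
       (let yk = y k (J k); vk = residual p g q (x k) (L k (J k)) yk in
         x (Suc k) = (if F yk < F (yk - vk) then yk else yk - vk))))"

definition accumulation_points :: "(nat \<Rightarrow> 'a::topological_space) \<Rightarrow> 'a set" where
  "accumulation_points x = {z. \<exists>r. strict_mono r \<and> (x \<circ> r) \<longlonglongrightarrow> z}"

section \<open>Standing assumptions\<close>

definition assumption_A1 ::
    "('a::euclidean_space \<Rightarrow> ereal) \<Rightarrow> ('a \<Rightarrow> ereal) \<Rightarrow> 'a set \<Rightarrow> bool" where
  "assumption_A1 f g U \<longleftrightarrow>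
     proper f \<and> lsc f \<and>
     open U \<and> closure (edom g) \<subseteq> U \<and> eC2_on U f \<and>
     proper g \<and> lsc g \<and> econvex g \<and>
     (\<exists>m::real. \<forall>x. ereal m \<le> f x + g x)"

definition assumption_A2 ::
    "('a::euclidean_space \<Rightarrow> ereal) \<Rightarrow> 'a set \<Rightarrow> (nat \<Rightarrow> 'a) \<Rightarrow> bool" where
  "assumption_A2 f U x \<longleftrightarrow>
     bounded (range x) \<and>
     (\<exists>N. open N \<and> convex N \<and> N \<subseteq> U \<and> accumulation_points x \<subseteq> N \<and>
          strictly_continuous_on N (hess (\<lambda>u. real_of_ereal (f u))))"

end

theory Submission
  imports Defs
begin

text \<open>The accepted step length \<open>D k\<close> is controlled from two sides. The line search decreases the
  objective by a fixed multiple of \<open>D k powr q\<close>. On the other hand, at the proximal point \<open>P k\<close> attached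
  to the accepted trial point the objective has a subgradient of size at most a multiple of
  \<open>D k powr (q - 1)\<close> (\<open>F_subgradient_small_near\<close>): it is the sum of the residual, of the gradient of the
  regularization term, and of a linearization error that is quadratic where the Hessian is Lipschitz.
  If \<open>\<phi>\<close> is the desingularizing function at an accumulation point and \<open>\<psi> k\<close> is \<open>\<phi>\<close> of the objective
  gap at the \<open>k\<close>-th iterate, concavity of \<open>\<phi>\<close> and the inequality of Kurdyka and Lojasiewicz combine
  these facts to
    \<open>D (k + 1) powr q \<le> const * (\<psi> (k + 1) - \<psi> (k + 2)) * D k powr (q - 1)\<close>,
  and hence to \<open>D (k + 1) \<le> D k / 2 + const * (\<psi> (k + 1) - \<psi> (k + 2))\<close>. The difference telescopes, which
  makes \<open>D\<close> summable and keeps the iterates near the accumulation point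
  (\<open>summable_of_local_recursion\<close>, \<open>finite_length\<close>).\<close>

text \<open>Two facts make these estimates uniform. The accepted coefficients are bounded
  (\<open>Lambda_bounded\<close>): a rejected trial with a large coefficient would be so short that the third-order
  Taylor remainder near an accumulation point is dominated by the regularization term, whose order is at
  most three. And the objective values converge to the value at the accumulation point
  (\<open>accumulation_point_value\<close>), which holds although \<open>g\<close> is only lower semicontinuous, because convexity
  provides the subgradient inequality at the proximal points. Since \<open>x (k + 1)\<close> is at most a multiple of
  \<open>D k\<close> away from \<open>x k\<close>, the iterates have finite length and converge; the limit is stationary
  because the subgradients at the points \<open>P k\<close> vanish in the limit (\<open>accumulation_point_stationary\<close>).\<close>

section \<open>Convex lower semicontinuous functions and the proximal map\<close>

lemma lsc_eventually_less:
  assumes "lsc h" "c < h x"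
  shows "eventually (\<lambda>z. c < h z) (nhds x)"
proof -
  have "h x \<le> Liminf (at x) h" using assms(1) by (auto simp: lsc_def)
  then have "eventually (\<lambda>z. c < h z) (at x)" using assms(2) by (auto simp: le_Liminf_iff)
  then show ?thesis using assms(2) by (simp add: eventually_nhds_conv_at)
qed

lemma lsc_attains_inf:
  fixes h :: "'a::metric_space \<Rightarrow> ereal"
  assumes "lsc h" "compact K" "K \<noteq> {}"
  shows "\<exists>p\<in>K. \<forall>z\<in>K. h p \<le> h z"
proof -
  have "h ` K \<noteq> {}" using assms(3) by blast
  from Inf_as_limit[OF this] obtain u where u: "\<forall>n. u n \<in> h ` K" "u \<longlonglongrightarrow> Inf (h ` K)" by metis
  have "\<forall>n. \<exists>v\<in>K. u n = h v" using u(1) by blast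
  then obtain w where w: "\<And>n. w n \<in> K" "\<And>n. u n = h (w n)" by metis
  have "\<forall>n. w n \<in> K" using w(1) by blast
  from seq_compactE[OF compact_imp_seq_compact[OF assms(2)] this]
  obtain p r where p: "p \<in> K" "strict_mono (r::nat\<Rightarrow>nat)" "(w \<circ> r) \<longlonglongrightarrow> p" by metis
  have lim: "(\<lambda>n. h (w (r n))) \<longlonglongrightarrow> Inf (h ` K)"
  proof -
    have "(u \<circ> r) \<longlonglongrightarrow> Inf (h ` K)" using u(2) p(2) by (rule LIMSEQ_subseq_LIMSEQ)
    moreover have "(u \<circ> r) = (\<lambda>n. h (w (r n)))" by (rule ext) (simp add: w(2))
    ultimately show ?thesis by (rule back_subst)
  qed
  have "h p \<le> Inf (h ` K)"
  proof (rule ccontr)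
    assume "\<not> h p \<le> Inf (h ` K)"
    then have "Inf (h ` K) < h p" by (rule not_le[THEN iffD1])
    then obtain c where c: "Inf (h ` K) < c" "c < h p" by (meson dense)
    have "eventually (\<lambda>n. c < h (w (r n))) sequentially"
      using filterlim_iff[THEN iffD1, OF p(3), rule_format, OF lsc_eventually_less[OF assms(1) c(2)]]
      by (simp add: o_def)
    then have "c \<le> Inf (h ` K)"
      by (intro tendsto_lowerbound[OF lim]) (auto elim: eventually_mono)
    with c(1) show False by simp
  qed
  then show ?thesis using p(1) by (meson INF_lower order_trans)
qed

lemma lsc_add_continuous:
  fixes h :: "'a::t2_space \<Rightarrow> ereal" and c :: "'a \<Rightarrow> real"
  assumes "lsc h" and "\<And>x. isCont c x"
  shows "lsc (\<lambda>x. ereal (c x) + h x)"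
  unfolding lsc_def le_Liminf_iff
proof (intro allI impI)
  fix x y assume "y < ereal (c x) + h x"
  then obtain r where r: "y < ereal r" "ereal r < ereal (c x) + h x" using ereal_dense2 by blast
  then have "ereal (r - c x) < h x" by (cases "h x") auto
  then obtain w where w: "ereal (r - c x) < ereal w" "ereal w < h x" using ereal_dense2 by blast
  have "eventually (\<lambda>z. ereal w < h z) (at x)"
    using lsc_eventually_less[OF assms(1) w(2)] by (simp add: eventually_nhds_conv_at)
  moreover have "eventually (\<lambda>z. r - w < c z) (at x)"
    using assms(2)[of x] w(1) by (intro order_tendstoD(1)[of c "c x"]) (auto simp: isCont_def)
  ultimately show "eventually (\<lambda>z. y < ereal (c z) + h z) (at x)"
  proof eventually_elim
    case (elim z)
    have "ereal r \<le> ereal (c z) + ereal w" using elim by simp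
    also have "\<dots> \<le> ereal (c z) + h z" using elim by (intro add_left_mono) auto
    finally show ?case using r(1) by simp
  qed
qed

lemma proper_edom_real:
  assumes "proper h" "z \<in> edom h"
  shows "h z = ereal (real_of_ereal (h z))"
  using assms by (cases "h z") (auto simp: proper_def edom_def)

lemma econvexD:
  assumes "econvex h" "t \<in> {0<..<1}"
  shows "h ((1 - t) *\<^sub>R x + t *\<^sub>R y) \<le> ereal (1 - t) * h x + ereal t * h y"
  using assms by (simp add: econvex_def)

text \<open>A convex function that is bounded below on a ball around a point of its domain cannot
  decrease faster than linearly along any ray from that point.\<close>

lemma convex_linear_lower_bound:
  fixes g :: "'a::euclidean_space \<Rightarrow> ereal"
  assumes "proper g" "lsc g" "econvex g"
  shows "\<exists>a\<ge>0. \<exists>b\<ge>0. \<forall>z. ereal (- (a + b * norm z)) \<le> g z"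
proof -
  obtain u where u: "u \<in> edom g" using assms(1) by (auto simp: proper_def)
  define s where "s = real_of_ereal (g u)"
  have gu: "g u = ereal s" using proper_edom_real[OF assms(1) u] by (simp add: s_def)
  obtain p where p: "p \<in> cball u 1" "\<forall>z\<in>cball u 1. g p \<le> g z"
    using lsc_attains_inf[OF assms(2) compact_cball, of u 1] by (metis centre_in_cball empty_iff zero_le_one)
  have "g p \<le> g u" using p(2) by auto
  then have gp: "p \<in> edom g" using u by (auto simp: edom_def)
  define m where "m = real_of_ereal (g p)"
  have m: "ereal m \<le> g z" if "z \<in> cball u 1" for z
    using p(2) that proper_edom_real[OF assms(1) gp] by (simp add: m_def)
  have ray: "ereal (s - norm (z - u) * (s - m)) \<le> g z" if "norm (z - u) > 1" for z
  proof (cases "g z")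
    case (real t)
    define r where "r = norm (z - u)"
    have r: "r > 1" using that by (simp add: r_def)
    have "ereal m \<le> g ((1 - 1/r) *\<^sub>R u + (1/r) *\<^sub>R z)"
    proof (rule m)
      have "(1 - 1/r) *\<^sub>R u + (1/r) *\<^sub>R z - u = (1/r) *\<^sub>R (z - u)"
        by (simp add: algebra_simps)
      then have "norm ((1 - 1/r) *\<^sub>R u + (1/r) *\<^sub>R z - u) \<le> 1" using r by (simp add: r_def[symmetric])
      then show "(1 - 1/r) *\<^sub>R u + (1/r) *\<^sub>R z \<in> cball u 1" by (simp add: dist_norm norm_minus_commute)
    qed
    also have "\<dots> \<le> ereal (1 - 1/r) * g u + ereal (1/r) * g z"
      using r by (intro econvexD[OF assms(3)]) auto
    finally have "m \<le> (1 - 1/r) * s + (1/r) * t" by (simp add: gu real)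
    then have "r * m \<le> r * ((1 - 1/r) * s + (1/r) * t)" using r by (intro mult_left_mono) auto
    also have "\<dots> = (r - 1) * s + t" using r by (simp add: field_simps)
    finally show ?thesis by (simp add: real r_def algebra_simps)
  next
    case MInf then show ?thesis using assms(1) by (auto simp: proper_def)
  qed auto
  define b where "b = \<bar>s - m\<bar>"
  define a where "a = \<bar>s\<bar> + \<bar>m\<bar> + b * norm u"
  have ab: "a \<ge> 0" "b \<ge> 0" by (auto simp: a_def b_def)
  have "ereal (- (a + b * norm z)) \<le> g z" for z
  proof -
    have bz: "b * norm (z - u) \<le> b * norm z + b * norm u"
      using mult_left_mono[OF norm_triangle_ineq4[of z u], of b] by (simp add: b_def algebra_simps)
    show ?thesis
    proof (cases "norm (z - u) > 1")
      case True
      have "norm (z - u) * (s - m) \<le> norm (z - u) * b" by (intro mult_left_mono) (auto simp: b_def)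
      then have "- (a + b * norm z) \<le> s - norm (z - u) * (s - m)"
        using bz unfolding a_def mult.commute[of "norm (z - u)" b] by linarith
      then show ?thesis by (intro order_trans[OF _ ray[OF True]]) simp
    next
      case False
      have "0 \<le> b * norm u" "0 \<le> b * norm z" by (auto simp: b_def)
      then have "- (a + b * norm z) \<le> m" by (simp add: a_def)
      moreover have "ereal m \<le> g z" using False by (intro m) (simp add: dist_norm norm_minus_commute)
      ultimately show ?thesis by (elim order_trans[rotated]) simp
    qed
  qed
  with ab show ?thesis by blast
qed

text \<open>\<open>prox\<close> is a chosen minimizer, so all its properties rest on the existence of one: by the linear
  lower bound the quadratic term wins outside a large ball, and inside the ball lower semicontinuity
  and compactness apply.\<close>

lemma prox_minimizes:
  fixes g :: "'a::euclidean_space \<Rightarrow> ereal"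
  assumes "proper g" "lsc g" "econvex g"
  shows "ereal (1 / 2 * (norm (prox g x - x))\<^sup>2) + g (prox g x)
       \<le> ereal (1 / 2 * (norm (z - x))\<^sup>2) + g z"
proof -
  let ?G = "\<lambda>z. ereal (1 / 2 * (norm (z - x))\<^sup>2) + g z"
  obtain a b where ab: "a \<ge> 0" "b \<ge> 0" "\<And>z. ereal (- (a + b * norm z)) \<le> g z"
    using convex_linear_lower_bound[OF assms] by metis
  obtain u where u: "u \<in> edom g" using assms(1) by (auto simp: proper_def)
  define c where "c = 1 / 2 * (norm (u - x))\<^sup>2 + real_of_ereal (g u)"
  have Gu: "?G u = ereal c" by (subst proper_edom_real[OF assms(1) u]) (simp add: c_def)
  \<comment> \<open>outside this ball the quadratic term dominates the linear lower bound\<close>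
  define R where "R = max (norm (u - x)) (2 * (b + \<bar>a + b * norm x + c\<bar> + 1))"
  have "u \<in> cball x R" by (simp add: R_def dist_norm norm_minus_commute)
  have "lsc ?G" by (intro lsc_add_continuous assms) (auto intro!: continuous_intros)
  then obtain p where p: "p \<in> cball x R" "\<forall>z\<in>cball x R. ?G p \<le> ?G z"
    using lsc_attains_inf[OF _ compact_cball, of ?G x R] \<open>u \<in> cball x R\<close> by blast
  have out: "?G u \<le> ?G z" if "z \<notin> cball x R" for z
  proof -
    define t where "t = norm (z - x)"
    have tR: "t > R" using that by (simp add: t_def dist_norm norm_minus_commute)
    have R: "R / 2 \<ge> b + \<bar>a + b * norm x + c\<bar> + 1" by (simp add: R_def)
    have "R \<ge> 2" using R ab(2) by linarith
    have "norm z \<le> t + norm x" using norm_triangle_sub[of z x] by (simp add: t_def)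
    then have n: "b * norm z \<le> b * t + b * norm x" using ab(2)
      by (metis distrib_left mult_left_mono)
    have dom: "t * (t / 2 - b) \<ge> 1 * \<bar>a + b * norm x + c\<bar>"
      using tR R \<open>R \<ge> 2\<close> by (intro mult_mono) auto
    have "c \<le> 1 / 2 * t\<^sup>2 - (a + b * norm z)"
    proof -
      have "t * (t / 2 - b) = 1 / 2 * t\<^sup>2 - b * t" by (simp add: algebra_simps power2_eq_square)
      then have "a + b * norm x + c \<le> 1 / 2 * t\<^sup>2 - b * t"
        using dom abs_ge_self[of "a + b * norm x + c"] by simp
      then show ?thesis using n by linarith
    qed
    then have "?G u \<le> ereal (1 / 2 * t\<^sup>2) + ereal (- (a + b * norm z))" unfolding Gu by simp
    also have "\<dots> \<le> ?G z" unfolding t_def by (intro add_left_mono ab(3))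
    finally show ?thesis .
  qed
  have all: "?G p \<le> ?G z" for z
  proof (cases "z \<in> cball x R")
    case False
    have "?G p \<le> ?G u" using p(2) \<open>u \<in> cball x R\<close> by blast
    also have "\<dots> \<le> ?G z" by (rule out[OF False])
    finally show ?thesis .
  qed (use p(2) in blast)
  have "is_arg_min ?G (\<lambda>z. True) p" unfolding is_arg_min_def using all not_le by blast
  then have "is_arg_min ?G (\<lambda>z. True) (prox g x)"
    unfolding prox_def arg_min_def by (rule someI)
  then show ?thesis unfolding is_arg_min_def using not_le by blast
qed

text \<open>Comparing the minimizer \<open>p\<close> with the points \<open>p + t (z - p)\<close> and letting \<open>t\<close> tend to \<open>0\<close>
  removes the quadratic term.\<close>

lemma prox_subgradient:
  fixes g :: "'a::euclidean_space \<Rightarrow> ereal"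
  assumes "proper g" "lsc g" "econvex g"
  shows "prox g x \<in> edom g"
    and "g (prox g x) + ereal ((x - prox g x) \<bullet> (z - prox g x)) \<le> g z"
proof -
  define p where "p = prox g x"
  note min = prox_minimizes[OF assms, of x, folded p_def]
  obtain u where u: "u \<in> edom g" using assms(1) by (auto simp: proper_def)
  show pd: "prox g x \<in> edom g"
  proof (rule ccontr)
    assume "prox g x \<notin> edom g"
    then have "g p = \<infinity>" by (simp add: p_def edom_def)
    then show False using min[of u] u by (simp add: edom_def)
  qed
  define s where "s = real_of_ereal (g p)"
  have gp: "g p = ereal s" using proper_edom_real[OF assms(1) pd] by (simp add: s_def p_def)
  show "g (prox g x) + ereal ((x - prox g x) \<bullet> (z - prox g x)) \<le> g z"
  proof (cases "g z")
    case (real r)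
    have ineq: "s - r \<le> (p - x) \<bullet> (z - p) + t * (1/2 * (norm (z - p))\<^sup>2)" if t: "t \<in> {0<..<1}" for t
    proof -
      let ?z = "(1 - t) *\<^sub>R p + t *\<^sub>R z"
      have "ereal (1 / 2 * (norm (p - x))\<^sup>2) + ereal s \<le> ereal (1 / 2 * (norm (?z - x))\<^sup>2) + g ?z"
        using min[of ?z] by (simp add: gp)
      also have "\<dots> \<le> ereal (1 / 2 * (norm (?z - x))\<^sup>2) + (ereal (1 - t) * g p + ereal t * g z)"
        using t by (intro add_left_mono econvexD[OF assms(3)]) auto
      also have "\<dots> = ereal (1 / 2 * (norm (?z - x))\<^sup>2 + (1 - t) * s + t * r)"
        by (simp add: gp real)
      finally have 1: "1 / 2 * (norm (p - x))\<^sup>2 + s \<le> 1 / 2 * (norm (?z - x))\<^sup>2 + (1 - t) * s + t * r"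
        by simp
      have "?z - x = (p - x) + t *\<^sub>R (z - p)" by (simp add: algebra_simps)
      then have "(norm (?z - x))\<^sup>2 = (norm (p - x))\<^sup>2 + 2 * t * ((p - x) \<bullet> (z - p)) + t\<^sup>2 * (norm (z - p))\<^sup>2"
        unfolding power2_norm_eq_inner
        by (simp add: inner_add_left inner_add_right inner_commute algebra_simps power2_eq_square)
      with 1 have "t * (s - r) \<le> t * ((p - x) \<bullet> (z - p) + t * (1/2 * (norm (z - p))\<^sup>2))"
        by (simp add: algebra_simps power2_eq_square)
      then show ?thesis using t by simp
    qed
    have "((\<lambda>t. (p - x) \<bullet> (z - p) + t * (1/2 * (norm (z - p))\<^sup>2)) \<longlongrightarrow>
        (p - x) \<bullet> (z - p) + 0 * (1/2 * (norm (z - p))\<^sup>2)) (at_right 0)"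
      by (intro tendsto_intros)
    moreover have "eventually (\<lambda>t. s - r \<le> (p - x) \<bullet> (z - p) + t * (1/2 * (norm (z - p))\<^sup>2)) (at_right 0)"
      using eventually_at_right_real[OF zero_less_one] by (rule eventually_mono) (rule ineq)
    ultimately have "s - r \<le> (p - x) \<bullet> (z - p) + 0 * (1/2 * (norm (z - p))\<^sup>2)"
      by (rule tendsto_lowerbound) simp
    then have "s + (x - p) \<bullet> (z - p) \<le> r"
      by (simp add: inner_diff_left algebra_simps)
    then show ?thesis by (simp add: real gp p_def[symmetric])
  next
    case MInf then show ?thesis using assms(1) by (auto simp: proper_def)
  qed auto
qed

section \<open>Second-order smoothness\<close>

lemma GDERIV_unique:
  assumes "GDERIV p x :> D" "GDERIV p x :> E"
  shows "D = E"
proof -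
  have "(\<lambda>h. h \<bullet> D) = (\<lambda>h. h \<bullet> E)"
    using assms unfolding gderiv_def by (rule has_derivative_unique)
  then have "h \<bullet> (D - E) = 0" for h by (metis inner_diff_right diff_self)
  from this[of "D - E"] show ?thesis by simp
qed

lemma grad_eqI:
  assumes "GDERIV p x :> D"
  shows "grad p x = D"
  unfolding grad_def using assms GDERIV_unique by blast

lemma GDERIV_grad:
  fixes p :: "'a::euclidean_space \<Rightarrow> real"
  assumes "p differentiable at x"
  shows "GDERIV p x :> grad p x"
proof -
  obtain f' where f': "(p has_derivative f') (at x)" using assms by (auto simp: differentiable_def)
  then have lin: "linear f'" by (rule has_derivative_linear)
  have "f' = (\<lambda>h. h \<bullet> (\<Sum>b\<in>Basis. f' b *\<^sub>R b))"
  proof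
    fix h
    have "f' h = f' (\<Sum>b\<in>Basis. (h \<bullet> b) *\<^sub>R b)" by (simp add: euclidean_representation)
    also have "\<dots> = (\<Sum>b\<in>Basis. (h \<bullet> b) * f' b)"
      by (simp add: linear_sum[OF lin] linear_scale[OF lin])
    finally show "f' h = h \<bullet> (\<Sum>b\<in>Basis. f' b *\<^sub>R b)" by (simp add: inner_sum_right mult.commute)
  qed
  then have "GDERIV p x :> (\<Sum>b\<in>Basis. f' b *\<^sub>R b)" using f' by (simp add: gderiv_def)
  then show ?thesis using grad_eqI by metis
qed

lemma C2_on_GDERIV:
  assumes "C2_on U p" "x \<in> U"
  shows "GDERIV p x :> grad p x"
  using assms by (intro GDERIV_grad) (auto simp: C2_on_def)

lemma C2_on_hess:
  assumes "C2_on U p" "x \<in> U"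
  shows "(grad p has_derivative blinfun_apply (hess p x)) (at x)"
proof -
  have d: "(grad p has_derivative frechet_derivative (grad p) (at x)) (at x)"
    using assms by (simp add: C2_on_def frechet_derivative_works)
  then have "bounded_linear (frechet_derivative (grad p) (at x))" by (rule has_derivative_bounded_linear)
  with d show ?thesis by (simp add: hess_def bounded_linear_Blinfun_apply)
qed

lemma C2_on_isCont:
  fixes p :: "'a::euclidean_space \<Rightarrow> real"
  assumes "open U" "C2_on U p" "x \<in> U"
  shows "isCont p x" "isCont (grad p) x" "isCont (hess p) x"
proof -
  show "isCont p x" using C2_on_GDERIV[OF assms(2,3)] has_derivative_continuous
    unfolding gderiv_def by blast
  show "isCont (grad p) x" using C2_on_hess[OF assms(2,3)] has_derivative_continuous by blast
  show "isCont (hess p) x"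
    using assms unfolding C2_on_def by (simp add: continuous_on_eq_continuous_at)
qed

lemma DERIV_along_line:
  fixes p :: "'a::euclidean_space \<Rightarrow> real"
  assumes "GDERIV p (a + s *\<^sub>R u) :> D"
  shows "((\<lambda>s. p (a + s *\<^sub>R u)) has_real_derivative u \<bullet> D) (at s)"
proof -
  have 1: "((\<lambda>s. a + s *\<^sub>R u) has_derivative (\<lambda>h. h *\<^sub>R u)) (at s)"
    by (auto intro!: derivative_eq_intros)
  have "((\<lambda>s. p (a + s *\<^sub>R u)) has_derivative (\<lambda>h. (h *\<^sub>R u) \<bullet> D)) (at s)"
    by (rule has_derivative_compose[OF 1 assms[unfolded gderiv_def]])
  then show ?thesis by (simp add: has_field_derivative_def mult_commute_abs)
qed

text \<open>The mean value theorem is applied along \<open>u\<close> to the difference of \<open>p\<close> over the step \<open>t v\<close>, and then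
  along \<open>v\<close> to the resulting difference of gradients. The left-hand side of the equation is symmetric
  in \<open>u\<close> and \<open>v\<close>, which is what makes it useful for the symmetry of the Hessian.\<close>

lemma second_difference_mvt:
  fixes p :: "'a::euclidean_space \<Rightarrow> real"
  assumes "C2_on U p" "ball x e \<subseteq> U" "t > 0" "t * (norm u + norm v) < e"
  obtains z where "dist x z \<le> t * (norm u + norm v)"
    "p (x + t *\<^sub>R u + t *\<^sub>R v) - p (x + t *\<^sub>R u) - p (x + t *\<^sub>R v) + p x
       = t\<^sup>2 * (blinfun_apply (hess p z) v \<bullet> u)"
proof -
  have near: "dist x (x + s *\<^sub>R u + r *\<^sub>R v) \<le> t * (norm u + norm v)"
    if "0 \<le> s" "s \<le> t" "0 \<le> r" "r \<le> t" for s r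
  proof -
    have "norm (s *\<^sub>R u + r *\<^sub>R v) \<le> s * norm u + r * norm v"
      using norm_triangle_ineq[of "s *\<^sub>R u" "r *\<^sub>R v"] that by simp
    also have "\<dots> \<le> t * norm u + t * norm v" using that by (intro add_mono mult_right_mono) auto
    finally show ?thesis by (simp add: dist_norm algebra_simps norm_minus_commute)
  qed
  then have inU: "x + s *\<^sub>R u + r *\<^sub>R v \<in> U" if "0 \<le> s" "s \<le> t" "0 \<le> r" "r \<le> t" for s r
    using that assms(2,4) by (meson le_less_trans mem_ball subsetD)
  let ?f = "\<lambda>s. p ((x + t *\<^sub>R v) + s *\<^sub>R u) - p (x + s *\<^sub>R u)"
  let ?g = "\<lambda>s. u \<bullet> grad p ((x + t *\<^sub>R v) + s *\<^sub>R u) - u \<bullet> grad p (x + s *\<^sub>R u)"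
  have "(?f has_real_derivative ?g s) (at s)" if "0 \<le> s" "s \<le> t" for s
    using inU[of s t] inU[of s 0] that assms(3)
    by (intro DERIV_diff DERIV_along_line C2_on_GDERIV[OF assms(1)]) (auto simp: add_ac)
  from MVT2[OF assms(3), of ?f ?g, OF this]
  obtain s where s: "0 < s" "s < t" "?f t - ?f 0 = (t - 0) * ?g s" by blast
  let ?h = "\<lambda>r. u \<bullet> grad p (x + s *\<^sub>R u + r *\<^sub>R v)"
  let ?k = "\<lambda>r. u \<bullet> blinfun_apply (hess p (x + s *\<^sub>R u + r *\<^sub>R v)) v"
  have "(?h has_real_derivative ?k r) (at r)" if "0 \<le> r" "r \<le> t" for r
  proof -
    have 1: "((\<lambda>r. x + s *\<^sub>R u + r *\<^sub>R v) has_derivative (\<lambda>h. h *\<^sub>R v)) (at r)"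
      by (auto intro!: derivative_eq_intros)
    have "(grad p has_derivative blinfun_apply (hess p (x + s *\<^sub>R u + r *\<^sub>R v))) (at (x + s *\<^sub>R u + r *\<^sub>R v))"
      using inU[of s r] s that by (intro C2_on_hess[OF assms(1)]) auto
    from has_derivative_inner_right[OF has_derivative_compose[OF 1 this], of u]
    show ?thesis by (simp add: has_field_derivative_def blinfun.scaleR_right mult_commute_abs)
  qed
  from MVT2[OF assms(3), of ?h ?k, OF this]
  obtain r where r: "0 < r" "r < t" "?h t - ?h 0 = (t - 0) * ?k r" by blast
  show thesis
  proof (rule that[of "x + s *\<^sub>R u + r *\<^sub>R v"])
    show "dist x (x + s *\<^sub>R u + r *\<^sub>R v) \<le> t * (norm u + norm v)" using s r by (intro near) auto
    have "?g s = ?h t - ?h 0" by (simp add: add_ac)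
    then have "?f t - ?f 0 = t * (t * ?k r)" using s(3) r(3) by simp
    then show "p (x + t *\<^sub>R u + t *\<^sub>R v) - p (x + t *\<^sub>R u) - p (x + t *\<^sub>R v) + p x
       = t\<^sup>2 * (blinfun_apply (hess p (x + s *\<^sub>R u + r *\<^sub>R v)) v \<bullet> u)"
      by (simp add: add_ac power2_eq_square inner_commute)
  qed
qed

text \<open>Both orders of differentiation give the same second difference, so \<open>hess p\<close> satisfies the symmetry
  at two points that can be taken arbitrarily close to \<open>x\<close>; continuity of the Hessian does the rest.\<close>

lemma hess_symmetric:
  fixes p :: "'a::euclidean_space \<Rightarrow> real"
  assumes "open U" "C2_on U p" "x \<in> U"
  shows "blinfun_apply (hess p x) u \<bullet> v = u \<bullet> blinfun_apply (hess p x) v"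
proof (rule ccontr)
  let ?a = "\<lambda>z. blinfun_apply (hess p z) u \<bullet> v" and ?b = "\<lambda>z. blinfun_apply (hess p z) v \<bullet> u"
  assume "?a x \<noteq> u \<bullet> blinfun_apply (hess p x) v"
  then have "\<bar>?a x - ?b x\<bar> / 2 > 0" by (simp add: inner_commute)
  then obtain d where d: "d > 0" "d = \<bar>?a x - ?b x\<bar> / 2" by blast
  obtain e0 where e0: "e0 > 0" "ball x e0 \<subseteq> U" using assms(1,3) openE by blast
  have cont: "isCont ?a x" "isCont ?b x"
    using C2_on_isCont(3)[OF assms] by (auto intro!: continuous_intros)
  obtain e1 where e1: "e1 > 0" "\<forall>z. dist z x < e1 \<longrightarrow> dist (?a z) (?a x) < d"
    using cont(1) d(1) unfolding continuous_at_eps_delta by blast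
  obtain e2 where e2: "e2 > 0" "\<forall>z. dist z x < e2 \<longrightarrow> dist (?b z) (?b x) < d"
    using cont(2) d(1) unfolding continuous_at_eps_delta by blast
  define e where "e = min e0 (min e1 e2)"
  have e: "e > 0" using e0 e1 e2 by (simp add: e_def)
  have eU: "ball x e \<subseteq> U" using e0(2) by (auto simp: e_def)
  define N where "N = norm u + norm v + 1"
  define t where "t = e / (2 * N)"
  have t: "t > 0" "t * (norm u + norm v) < e"
  proof -
    have pos: "N > 0" using norm_ge_zero[of u] norm_ge_zero[of v] unfolding N_def by linarith
    then show "t > 0" using e by (simp add: t_def)
    have "t * (norm u + norm v) < t * N" using \<open>t > 0\<close> by (simp add: N_def)
    also have "\<dots> = e / 2" using pos by (simp add: t_def)
    finally show "t * (norm u + norm v) < e" using e by simp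
  qed
  obtain z1 where z1: "dist x z1 \<le> t * (norm u + norm v)"
    "p (x + t *\<^sub>R u + t *\<^sub>R v) - p (x + t *\<^sub>R u) - p (x + t *\<^sub>R v) + p x = t\<^sup>2 * ?b z1"
    using second_difference_mvt[OF assms(2) eU t] by metis
  have t': "t * (norm v + norm u) < e" using t(2) by (simp add: add.commute)
  obtain z2 where z2: "dist x z2 \<le> t * (norm v + norm u)"
    "p (x + t *\<^sub>R v + t *\<^sub>R u) - p (x + t *\<^sub>R v) - p (x + t *\<^sub>R u) + p x = t\<^sup>2 * ?a z2"
    using second_difference_mvt[OF assms(2) eU t(1) t'] by metis
  have swap: "x + t *\<^sub>R v + t *\<^sub>R u = x + t *\<^sub>R u + t *\<^sub>R v" by simp
  have "t\<^sup>2 * ?b z1 = t\<^sup>2 * ?a z2" using z1(2) z2(2) unfolding swap by linarith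
  then have "?b z1 = ?a z2" using t(1) by simp
  moreover have "dist (?b z1) (?b x) < d" 
    using z1(1) t(2) by (intro e2(2)[rule_format]) (simp add: dist_commute e_def)
  moreover have "dist (?a z2) (?a x) < d" 
    using z2(1) t' by (intro e1(2)[rule_format]) (simp add: dist_commute e_def)
  ultimately have "\<bar>?a z2 - ?b x\<bar> < d" "\<bar>?a z2 - ?a x\<bar> < d" by (simp_all add: dist_real_def)
  then show False using d(2) by (simp add: abs_if split: if_splits)
qed

text \<open>Differentiating the quadratic form yields the mean of the Hessian and its adjoint applied to
  \<open>z - x\<close>; only symmetry turns this into the Hessian itself.\<close>

lemma GDERIV_taylor2:
  fixes p :: "'a::euclidean_space \<Rightarrow> real"
  assumes "open U" "C2_on U p" "x \<in> U"
  shows "GDERIV (taylor2 p x) z :> grad p x + blinfun_apply (hess p x) (z - x)"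
proof -
  have "(taylor2 p x has_derivative (\<lambda>h. grad p x \<bullet> h +
      1/2 * (blinfun_apply (hess p x) h \<bullet> (z - x) + blinfun_apply (hess p x) (z - x) \<bullet> h))) (at z)"
    unfolding taylor2_def by (auto intro!: derivative_eq_intros simp: inner_commute add_ac)
  moreover have "blinfun_apply (hess p x) h \<bullet> (z - x) = blinfun_apply (hess p x) (z - x) \<bullet> h" for h
    using hess_symmetric[OF assms, of h "z - x"] by (simp add: inner_commute)
  ultimately show ?thesis
    by (simp add: gderiv_def inner_add_right inner_commute)
qed

lemma grad_linearization_error:
  fixes p :: "'a::euclidean_space \<Rightarrow> real"
  assumes "C2_on U p" "convex S" "S \<subseteq> U" "x \<in> S" "y \<in> S"
    and K: "\<And>z. z \<in> S \<Longrightarrow> norm (hess p z - hess p x) \<le> K"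
  shows "norm (grad p y - grad p x - blinfun_apply (hess p x) (y - x)) \<le> K * norm (y - x)"
proof -
  let ?G = "\<lambda>z. grad p z - blinfun_apply (hess p x) z"
  have "norm (?G y - ?G x) \<le> K * norm (y - x)"
  proof (rule differentiable_bound[OF assms(2), where f = ?G
      and f' = "\<lambda>z. blinfun_apply (hess p z - hess p x)"])
    fix z assume z: "z \<in> S"
    have "(grad p has_derivative blinfun_apply (hess p z)) (at z within S)"
      using z assms(3) by (blast intro: has_derivative_at_withinI C2_on_hess[OF assms(1)])
    moreover have "(blinfun_apply (hess p x) has_derivative blinfun_apply (hess p x)) (at z within S)"
      by (intro bounded_linear_imp_has_derivative blinfun.bounded_linear_right)
    ultimately have "(?G has_derivative (\<lambda>h. blinfun_apply (hess p z) h - blinfun_apply (hess p x) h)) (at z within S)"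
      by (rule has_derivative_diff)
    moreover have "(\<lambda>h. blinfun_apply (hess p z) h - blinfun_apply (hess p x) h) = blinfun_apply (hess p z - hess p x)"
      by (rule ext) (simp add: blinfun.diff_left)
    ultimately show "(?G has_derivative blinfun_apply (hess p z - hess p x)) (at z within S)" by simp
    show "onorm (blinfun_apply (hess p z - hess p x)) \<le> K"
      unfolding norm_blinfun.rep_eq[symmetric] by (rule K[OF z])
  qed (use assms(4,5) in auto)
  then show ?thesis by (simp add: blinfun.diff_right algebra_simps)
qed

text \<open>Both constants are those of the mean value inequality on the segment from \<open>x\<close> to \<open>y\<close>, where
  the distance to \<open>x\<close> never exceeds \<open>norm (y - x)\<close>: once for the gradient, and once more for the
  remainder of \<open>p\<close>, whose gradient is the linearization error of the gradient of \<open>p\<close>.\<close>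

lemma taylor2_error:
  fixes p :: "'a::euclidean_space \<Rightarrow> real"
  assumes "open U" "C2_on U p" "ball c e \<subseteq> U" "x \<in> ball c e" "y \<in> ball c e" "K \<ge> 0"
    and K: "\<And>z. z \<in> ball c e \<Longrightarrow> norm (hess p z - hess p x) \<le> K * norm (z - x)"
  shows "\<bar>p y - taylor2 p x y\<bar> \<le> K * norm (y - x) ^ 3"
    and "norm (grad p y - grad p x - blinfun_apply (hess p x) (y - x)) \<le> K * norm (y - x) ^ 2"
proof -
  have xU: "x \<in> U" using assms by auto
  have seg: "closed_segment x y \<subseteq> ball c e" using assms by (intro closed_segment_subset) auto
  have 1: "norm (grad p z - grad p x - blinfun_apply (hess p x) (z - x)) \<le> K * norm (y - x) ^ 2"
    if z: "z \<in> closed_segment x y" for z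
  proof -
    have zn: "norm (w - x) \<le> norm (y - x)" if "w \<in> closed_segment x y" for w
      using segment_bound(1)[OF that] by (simp add: norm_minus_commute)
    have "norm (grad p z - grad p x - blinfun_apply (hess p x) (z - x)) \<le> (K * norm (y - x)) * norm (z - x)"
    proof (rule grad_linearization_error[OF assms(2) convex_closed_segment, of x y])
      show "closed_segment x y \<subseteq> U" using seg assms(3) by blast
      fix w assume w: "w \<in> closed_segment x y"
      then have "norm (hess p w - hess p x) \<le> K * norm (w - x)" using seg by (intro K) auto
      also have "\<dots> \<le> K * norm (y - x)" using zn[OF w] assms(6) by (intro mult_left_mono)
      finally show "norm (hess p w - hess p x) \<le> K * norm (y - x)" .
    qed (use z in auto)
    also have "\<dots> \<le> (K * norm (y - x)) * norm (y - x)"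
      using zn[OF z] assms(6) by (intro mult_left_mono) auto
    finally show ?thesis by (simp add: power2_eq_square)
  qed
  from 1[of y] show "norm (grad p y - grad p x - blinfun_apply (hess p x) (y - x)) \<le> K * norm (y - x) ^ 2"
    by simp
  let ?r = "\<lambda>z. p z - taylor2 p x z"
  have "norm (?r y - ?r x) \<le> (K * norm (y - x) ^ 2) * norm (y - x)"
  proof (rule differentiable_bound[OF convex_closed_segment[of x y], where f = ?r
      and f' = "\<lambda>z h. h \<bullet> (grad p z - (grad p x + blinfun_apply (hess p x) (z - x)))"])
    fix z assume z: "z \<in> closed_segment x y"
    let ?D = "grad p z - (grad p x + blinfun_apply (hess p x) (z - x))"
    have "GDERIV ?r z :> ?D"
      using z seg assms(3) by (intro GDERIV_diff C2_on_GDERIV[OF assms(2)] GDERIV_taylor2[OF assms(1,2) xU]) auto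
    then show "(?r has_derivative (\<lambda>h. h \<bullet> ?D)) (at z within closed_segment x y)"
      unfolding gderiv_def by (rule has_derivative_at_withinI)
    have "onorm (\<lambda>h. h \<bullet> ?D) \<le> norm ?D"
      by (rule onorm_bound) (auto intro: Cauchy_Schwarz_ineq2[THEN order_trans] simp: mult.commute)
    also have "\<dots> \<le> K * norm (y - x) ^ 2" using 1[OF z] by (simp add: algebra_simps)
    finally show "onorm (\<lambda>h. h \<bullet> ?D) \<le> K * norm (y - x) ^ 2" .
  qed auto
  moreover have "?r x = 0" by (simp add: taylor2_def)
  ultimately show "\<bar>p y - taylor2 p x y\<bar> \<le> K * norm (y - x) ^ 3"
    by (simp add: power2_eq_square power3_eq_cube mult.assoc)
qed

text \<open>At the centre the norm is not differentiable, but a power of order larger than one is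
  negligible there, and the formula gives the correct value \<open>0\<close>.\<close>

lemma GDERIV_norm_powr:
  fixes c :: "'a::euclidean_space"
  assumes "q \<ge> 2"
  shows "GDERIV (\<lambda>z. norm (z - c) powr q) z :> (q * norm (z - c) powr (q - 2)) *\<^sub>R (z - c)"
proof (cases "z = c")
  case True
  have "((\<lambda>h::'a. norm h powr (q - 1)) \<longlongrightarrow> 0) (at 0)"
    using assms by (intro tendsto_zero_powrI[where b = "q - 1"]) (auto intro!: tendsto_eq_intros)
  moreover have "norm h powr (q - 1) = norm (norm h powr q) / norm h" for h :: 'a
    by (cases "h = 0") (auto simp: powr_diff)
  ultimately have "((\<lambda>h::'a. norm (norm h powr q) / norm h) \<longlongrightarrow> 0) (at 0)" by simp
  then have "((\<lambda>z. norm (z - c) powr q) has_derivative (\<lambda>h. 0)) (at c)"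
    using assms by (simp add: has_derivative_at)
  then show ?thesis using True by (simp add: gderiv_def)
next
  case False
  have "((\<lambda>z. z - c) has_derivative (\<lambda>h. h)) (at z)" by (auto intro!: derivative_eq_intros)
  from has_derivative_compose[OF this, of norm "\<lambda>h. h \<bullet> sgn (z - c)"]
  have 1: "GDERIV (\<lambda>z. norm (z - c)) z :> sgn (z - c)"
    using GDERIV_norm[of "z - c"] False by (simp add: gderiv_def)
  have 2: "((\<lambda>r. r powr q) has_real_derivative q * norm (z - c) powr (q - 1)) (at (norm (z - c)))"
    using False by (intro has_real_derivative_powr) simp
  have "(q * norm (z - c) powr (q - 1)) *\<^sub>R sgn (z - c) = (q * norm (z - c) powr (q - 2)) *\<^sub>R (z - c)"
    using False powr_add[of "norm (z - c)" "q - 2" 1] by (simp add: sgn_div_norm divide_simps)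
  with GDERIV_DERIV_compose[OF 1 2] show ?thesis by simp
qed

lemma grad_reg_model:
  fixes p :: "'a::euclidean_space \<Rightarrow> real"
  assumes "open U" "C2_on U p" "x \<in> U" "q \<ge> 2"
  shows "grad (reg_model p q x M) z
    = grad p x + blinfun_apply (hess p x) (z - x) + (M * norm (z - x) powr (q - 2)) *\<^sub>R (z - x)"
proof (rule grad_eqI)
  have "GDERIV (\<lambda>z. taylor2 p x z + (M / q) * norm (z - x) powr q) z :>
     grad p x + blinfun_apply (hess p x) (z - x) +
     ((M / q) *\<^sub>R ((q * norm (z - x) powr (q - 2)) *\<^sub>R (z - x)) + (norm (z - x) powr q) *\<^sub>R 0)"
    by (intro GDERIV_add GDERIV_taylor2[OF assms(1-3)] GDERIV_mult GDERIV_const GDERIV_norm_powr assms)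
  moreover have "(M / q) *\<^sub>R ((q * norm (z - x) powr (q - 2)) *\<^sub>R (z - x)) + (norm (z - x) powr q) *\<^sub>R 0
     = (M * norm (z - x) powr (q - 2)) *\<^sub>R (z - x)"
    using assms(4) by simp
  ultimately show "GDERIV (reg_model p q x M) z :>
    grad p x + blinfun_apply (hess p x) (z - x) + (M * norm (z - x) powr (q - 2)) *\<^sub>R (z - x)"
    using assms(4) unfolding reg_model_def[abs_def] by simp
qed

section \<open>Subgradients and desingularizing functions\<close>

text \<open>A convex subgradient of \<open>g\<close> supports \<open>g\<close> globally, so only the first-order error of the smooth
  summand enters the difference quotient of \<open>f + g\<close>.\<close>

lemma regular_subdiff_sum:
  fixes f g :: "'a::euclidean_space \<Rightarrow> ereal"
  assumes "open U" "p \<in> U"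
    and fin: "\<And>z. z \<in> U \<Longrightarrow> f z = ereal (h z)"
    and D: "GDERIV h p :> D"
    and gp: "\<bar>g p\<bar> \<noteq> \<infinity>"
    and xi: "\<And>z. g p + ereal (\<xi> \<bullet> (z - p)) \<le> g z"
  shows "D + \<xi> \<in> regular_subdiff (\<lambda>z. f z + g z) p"
proof -
  define s where "s = real_of_ereal (g p)"
  have gs: "g p = ereal s" using gp by (simp add: s_def ereal_real)
  have Fp: "f p + g p = ereal (h p + s)" using fin[OF assms(2)] gs by simp
  have "0 \<le> Liminf (at p) (\<lambda>z. (f z + g z - (f p + g p) - ereal ((D + \<xi>) \<bullet> (z - p))) / ereal (norm (z - p)))"
    unfolding le_Liminf_iff
  proof (intro allI impI)
    fix y :: ereal assume "y < 0"
    then obtain r where r: "y < ereal r" "ereal r < 0" using ereal_dense2 by blast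
    then have "- r > 0" by simp
    then obtain d where d: "d > 0"
      "\<And>z. norm (z - p) < d \<Longrightarrow> norm (h z - h p - (z - p) \<bullet> D) \<le> (- r) * norm (z - p)"
      using D unfolding gderiv_def has_derivative_at_alt by blast
    have "eventually (\<lambda>z. z \<in> U) (at p)" using assms(1,2) by (rule eventually_at_in_open')
    moreover have "eventually (\<lambda>z. norm (z - p) < d) (at p)"
      unfolding eventually_at using d(1) by (auto simp: dist_norm)
    moreover have "eventually (\<lambda>z. z \<noteq> p) (at p)" by (simp add: eventually_at_filter)
    ultimately show "eventually (\<lambda>z. y < (f z + g z - (f p + g p) - ereal ((D + \<xi>) \<bullet> (z - p))) / ereal (norm (z - p))) (at p)"
    proof eventually_elim
      case (elim z)
      have pos: "norm (z - p) > 0" using elim by simp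
      show ?case
      proof (cases "g z")
        case (real t)
        have "s + \<xi> \<bullet> (z - p) \<le> t" using xi[of z] by (simp add: gs real)
        moreover have "\<bar>h z - h p - (z - p) \<bullet> D\<bar> \<le> (- r) * norm (z - p)" using d(2) elim by simp
        ultimately have "r * norm (z - p) \<le> h z + t - (h p + s) - (D + \<xi>) \<bullet> (z - p)"
          unfolding inner_add_left inner_commute[of D] by linarith
        then have "r \<le> (h z + t - (h p + s) - (D + \<xi>) \<bullet> (z - p)) / norm (z - p)"
          using pos by (simp add: le_divide_eq)
        also have "ereal \<dots> = (f z + g z - (f p + g p) - ereal ((D + \<xi>) \<bullet> (z - p))) / ereal (norm (z - p))"
          using pos elim by (simp add: Fp fin real)
        finally show ?thesis using r(1) by (metis ereal_less_eq(3) less_le_trans)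
      next
        case PInf
        then show ?thesis using pos r elim by (cases y) (simp_all add: Fp fin)
      next
        case MInf
        then show ?thesis using xi[of z] by (simp add: gs)
      qed
    qed
  qed
  then show ?thesis by (simp add: regular_subdiff_def Fp)
qed

lemma limiting_subdiffI:
  assumes "\<bar>h x\<bar> \<noteq> \<infinity>" "u \<longlonglongrightarrow> x" "(\<lambda>n. h (u n)) \<longlonglongrightarrow> h x"
    "\<And>n. w n \<in> regular_subdiff h (u n)" "w \<longlonglongrightarrow> v"
  shows "v \<in> limiting_subdiff h x"
  unfolding limiting_subdiff_def using assms by blast

lemma regular_subset_limiting_subdiff: "regular_subdiff h x \<subseteq> limiting_subdiff h x"
proof
  fix v assume v: "v \<in> regular_subdiff h x"
  then show "v \<in> limiting_subdiff h x"
    by (intro limiting_subdiffI[where u = "\<lambda>_. x" and w = "\<lambda>_. v"]) (simp_all add: regular_subdiff_def)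
qed

lemma edist_to_le: "w \<in> S \<Longrightarrow> edist_to 0 S \<le> ereal (norm w)"
  unfolding edist_to_def by (rule INF_lower2) auto

text \<open>A concave function lies below its tangents; \<open>a\<close> has to be an interior point of the domain, hence
  positive, while \<open>b = 0\<close> is permitted.\<close>

lemma KL_desing_tangent:
  assumes "p \<in> KL_desing w" "0 < a" "ereal a < w" "0 \<le> b" "ereal b < w"
  shows "p b \<le> p a + deriv p a * (b - a)"
proof -
  let ?I = "{t. 0 \<le> t \<and> ereal t < w}"
  have int: "a \<in> interior ?I"
  proof (rule interiorI)
    show "open {t. 0 < t \<and> ereal t < w}"
    proof -
      have "{t. 0 < t \<and> ereal t < w} = {0<..} \<inter> {t. ereal t < w}" by auto
      moreover have "open {t. ereal t < w}"
        by (rule open_Collect_less[OF continuous_on_ereal[OF continuous_on_id] continuous_on_const])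
      ultimately show ?thesis by (metis open_Int open_greaterThan)
    qed
  qed (use assms in auto)
  have "concave_on ?I p" "p differentiable at a" using assms by (auto simp: KL_desing_def)
  have cv: "convex_on ?I (\<lambda>t. - p t)" using \<open>concave_on ?I p\<close> by (simp add: concave_on_def)
  have "(p has_real_derivative deriv p a) (at a)"
    using \<open>p differentiable at a\<close> real_differentiable_def DERIV_imp_deriv by blast
  then have d: "((\<lambda>t. - p t) has_real_derivative - deriv p a) (at a within ?I)"
    by (rule has_field_derivative_at_within[OF DERIV_minus])
  have "connected ?I" using convex_on_imp_convex[OF cv] convex_connected by blast
  from convex_on_imp_above_tangent[OF cv this int _ d, of b] assms
  show ?thesis by (simp add: algebra_simps)
qed

lemma KL_desing_deriv_antimono:
  assumes "p \<in> KL_desing w" "0 < b" "b \<le> a" "ereal a < w"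
  shows "deriv p a \<le> deriv p b"
proof (cases "b = a")
  case False
  have bw: "ereal b < w" using assms(3,4) by (metis ereal_less_eq(3) le_less_trans)
  have "p b \<le> p a + deriv p a * (b - a)" using assms bw by (intro KL_desing_tangent) auto
  moreover have "p a \<le> p b + deriv p b * (a - b)" using assms bw by (intro KL_desing_tangent) auto
  ultimately have "deriv p a * (a - b) \<le> deriv p b * (a - b)" by (simp add: algebra_simps)
  then show ?thesis using assms False by simp
qed simp

lemma KL_desing_tendsto_0:
  assumes "p \<in> KL_desing w" "e \<longlonglongrightarrow> 0" "eventually (\<lambda>n. 0 \<le> e n \<and> ereal (e n) < w) sequentially" "0 < w"
  shows "(\<lambda>n. p (e n)) \<longlonglongrightarrow> 0"
proof -
  have "continuous_on {t. 0 \<le> t \<and> ereal t < w} p" "p 0 = 0" using assms(1) by (auto simp: KL_desing_def)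
  then show ?thesis
    using continuous_on_tendsto_compose[of "{t. 0 \<le> t \<and> ereal t < w}" p e 0 sequentially] assms(2-4)
    by (simp add: zero_ereal_def)
qed

section \<open>Scalar inequalities and sequences of finite length\<close>

text \<open>If \<open>s\<close> exceeds \<open>r / 2\<close>, then \<open>r powr (q - 1) \<le> 4 * s powr (q - 1)\<close> because \<open>q - 1 \<le> 2\<close>, and
  \<open>s powr (q - 1)\<close> cancels. This is Young's inequality with cruder constants; what matters later is
  that the coefficient of \<open>r\<close> is below one.\<close>

lemma powr_ratio_step:
  fixes r s :: real
  assumes q: "2 \<le> q" "q \<le> 3" and "0 \<le> r" "0 \<le> s" "0 < c" "0 \<le> B" "0 \<le> d"
    and step: "c * s powr q \<le> d * (B * r powr (q - 1))"
  shows "s \<le> r / 2 + 4 * B / c * d"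
proof (cases "s \<le> r / 2")
  case True
  then show ?thesis using assms by (simp add: add_increasing2)
next
  case False
  then have s: "s > 0" "r \<le> 2 * s" using assms by auto
  have "r powr (q - 1) \<le> (2 * s) powr (q - 1)" using s assms by (intro powr_mono2) auto
  also have "\<dots> = 2 powr (q - 1) * s powr (q - 1)" using s by (simp add: powr_mult)
  also have "\<dots> \<le> 2 powr 2 * s powr (q - 1)" using q by (intro mult_right_mono powr_mono) auto
  finally have r: "r powr (q - 1) \<le> 4 * s powr (q - 1)" by simp
  have "s powr q = s * s powr (q - 1)" using s powr_add[of s 1 "q - 1"] by simp
  then have "(c * s) * s powr (q - 1) \<le> d * (B * r powr (q - 1))" using step by simp
  also have "\<dots> \<le> d * (B * (4 * s powr (q - 1)))" using r assms by (intro mult_left_mono) auto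
  finally have "(c * s) * s powr (q - 1) \<le> (4 * B * d) * s powr (q - 1)" by (simp add: algebra_simps)
  then have "c * s \<le> 4 * B * d" using s by simp
  then have "s \<le> 4 * B / c * d" using assms by (simp add: field_simps)
  then show ?thesis using assms(3) by simp
qed

text \<open>The finite-length argument behind Kurdyka--Lojasiewicz convergence theorems. The recursion is
  available only while the sequence stays near \<open>xb\<close>, and the sequence stays there because the recursion
  keeps its length small. Along indices where the recursion holds, the partial sum of \<open>D\<close> plus
  \<open>2 D n + 2 M \<psi> (n + 1)\<close> does not increase. Starting at an index where \<open>x\<close> is close to \<open>xb\<close> and
  this quantity is small, the length of the remaining path is too short to leave the ball.\<close>

lemma summable_of_local_recursion:
  fixes x :: "nat \<Rightarrow> 'a::real_normed_vector" and D \<psi> :: "nat \<Rightarrow> real"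
  assumes D: "\<And>k. 0 \<le> D k" "D \<longlonglongrightarrow> 0"
    and \<psi>: "\<And>k. k \<ge> K0 \<Longrightarrow> 0 \<le> \<psi> k" "\<psi> \<longlonglongrightarrow> 0"
    and A: "0 \<le> A" "\<And>k. norm (x (Suc k) - x k) \<le> A * D k"
    and M: "0 \<le> M"
    and \<epsilon>: "0 < \<epsilon>"
    and step: "\<And>k. k \<ge> K0 \<Longrightarrow> norm (x k - xb) < \<epsilon> \<Longrightarrow>
       D (Suc k) \<le> D k / 2 + M * (\<psi> (Suc k) - \<psi> (Suc (Suc k)))"
    and acc: "\<And>K \<delta>. 0 < \<delta> \<Longrightarrow> \<exists>k\<ge>K. norm (x k - xb) < \<delta>"
  shows "summable D"
proof -
  \<comment> \<open>the factors 2 sum the geometric series with ratio \<open>1/2\<close> that the recursion produces\<close>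
  define W where "W k = 2 * D k + 2 * M * \<psi> (Suc k)" for k
  have "W \<longlonglongrightarrow> 2 * 0 + 2 * M * 0"
    unfolding W_def by (intro tendsto_intros D \<psi> LIMSEQ_Suc[OF \<psi>(2)])
  then have "(\<lambda>k. A * W k) \<longlonglongrightarrow> 0" by (auto intro: tendsto_mult_right_zero)
  then have "eventually (\<lambda>k. A * W k < \<epsilon> / 2) sequentially" using \<epsilon> by (intro order_tendstoD) auto
  then obtain K1 where K1: "\<And>k. k \<ge> K1 \<Longrightarrow> A * W k < \<epsilon> / 2" by (auto simp: eventually_sequentially)
  obtain K where K: "K \<ge> max K0 K1" "norm (x K - xb) < \<epsilon> / 2" using acc[of "\<epsilon> / 2" "max K0 K1"] \<epsilon> by auto
  have W0: "0 \<le> W k" if "k \<ge> K" for k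
    using D(1)[of k] \<psi>(1)[of "Suc k"] M that K(1) by (simp add: W_def)
  have inv: "norm (x (K + n) - x K) \<le> A * (\<Sum>i<n. D (K + i)) \<and> (\<Sum>i<n. D (K + i)) + W (K + n) \<le> W K" for n
  proof (induction n)
    case (Suc n)
    let ?S = "\<Sum>i<n. D (K + i)"
    have "A * ?S \<le> A * W K" using Suc W0[of "K + n"] A(1) by (intro mult_left_mono) auto
    also have "\<dots> < \<epsilon> / 2" using K1 K(1) by simp
    finally have "norm (x (K + n) - x K) < \<epsilon> / 2" using Suc by simp
    then have "norm (x (K + n) - xb) < \<epsilon>"
      using norm_triangle_lt[of "x (K + n) - x K" "x K - xb" \<epsilon>] K(2) by simp
    then have "D (Suc (K + n)) \<le> D (K + n) / 2 + M * (\<psi> (Suc (K + n)) - \<psi> (Suc (Suc (K + n))))"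
      using K(1) by (intro step) auto
    then have "D (K + n) + W (Suc (K + n)) \<le> W (K + n)" by (simp add: W_def algebra_simps)
    moreover have "norm (x (Suc (K + n)) - x K) \<le> A * D (K + n) + A * ?S"
      using norm_triangle_mono[OF A(2)[of "K + n"] conjunct1[OF Suc]] by simp
    ultimately show ?case using Suc by (simp add: algebra_simps)
  qed simp
  have "summable (\<lambda>i. D (K + i))"
  proof (rule summableI_nonneg_bounded)
    show "0 \<le> D (K + i)" for i by (rule D)
    show "(\<Sum>i<n. D (K + i)) \<le> W K" for n using inv[of n] W0[of "K + n"] by simp
  qed
  then show ?thesis using summable_iff_shift[of D K] by (simp add: add.commute)
qed

text \<open>Regularization of order \<open>q \<le> 3\<close> with a large coefficient forces short steps. The cube is the power
  in which the Taylor remainder of the line search is measured.\<close>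

lemma large_coefficient_small_step:
  fixes d M C :: real
  assumes q: "2 \<le> q" "q \<le> 3" and "0 \<le> d" "0 \<le> C" "3 * C < M"
    and le: "M * d powr q \<le> C * (1 + d + d\<^sup>2)"
  shows "d < 1" "M * d ^ 3 \<le> 3 * C"
proof -
  have M: "M > 0" using assms by simp
  show d1: "d < 1"
  proof (rule ccontr)
    assume "\<not> d < 1"
    then have d: "1 \<le> d" by simp
    have "d \<le> d\<^sup>2" using d by (simp add: power2_eq_square)
    then have "1 + d + d\<^sup>2 \<le> 3 * d\<^sup>2" using d by linarith
    then have "C * (1 + d + d\<^sup>2) \<le> C * (3 * d\<^sup>2)" using assms(4) by (rule mult_left_mono)
    moreover have "d powr 2 \<le> d powr q" using d q by (intro powr_mono)
    then have "M * d\<^sup>2 \<le> M * d powr q" using M d by (intro mult_left_mono) auto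
    ultimately have "M * d\<^sup>2 \<le> (3 * C) * d\<^sup>2" using le by (simp add: algebra_simps)
    then show False using d assms(5) by simp
  qed
  have "d ^ 3 \<le> d powr q"
  proof (cases "d = 0")
    case False
    have "d powr 3 \<le> d powr q" using False d1 q assms(3) by (intro powr_mono') auto
    then show ?thesis using False assms(3) by simp
  qed simp
  then have "M * d ^ 3 \<le> M * d powr q" using M by (intro mult_left_mono) auto
  also have "\<dots> \<le> C * (1 + d + d\<^sup>2)" by (rule le)
  also have "\<dots> \<le> C * 3"
  proof (rule mult_left_mono)
    have "d\<^sup>2 \<le> 1" using d1 assms(3) by (simp add: power_le_one)
    then show "1 + d + d\<^sup>2 \<le> 3" using d1 by simp
  qed (rule assms)
  finally show "M * d ^ 3 \<le> 3 * C" by simp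
qed

section \<open>Descent along a run\<close>

locale regularized_newton_run =
  fixes f g :: "'a::euclidean_space \<Rightarrow> ereal"
    and U :: "'a set"
    and q Lm LM \<rho> \<sigma> \<tau> :: real
    and x :: "nat \<Rightarrow> 'a"
    and L :: "nat \<Rightarrow> nat \<Rightarrow> real"
    and y :: "nat \<Rightarrow> nat \<Rightarrow> 'a"
    and J :: "nat \<Rightarrow> nat"
  assumes q: "2 \<le> q" "q \<le> 3"
    and Lm: "0 < Lm"
    and rho: "0 < \<rho>" "\<rho> < 1"
    and sigma: "0 < \<sigma>" "\<sigma> < 1"
    and tau: "1 < \<tau>"
    and A1: "assumption_A1 f g U"
    and run: "algorithm_run f g q Lm LM \<rho> \<sigma> \<tau> x L y J"
    and A2: "assumption_A2 f U x"
begin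

text \<open>The extended-valued data are replaced by real functions, which agree with them on the domain of
  \<open>g\<close>, and all iterates lie there. The sequences \<open>Y\<close>, \<open>V\<close> and \<open>P\<close> are the accepted trial
  point, its residual, and the proximal point from which the residual is measured; the next iterate is
  the better of \<open>Y k\<close> and \<open>P k\<close>. Subgradients of the objective are available at \<open>P k\<close>.\<close>

definition h :: "'a \<Rightarrow> real" where "h u = real_of_ereal (f u)"
definition G :: "'a \<Rightarrow> real" where "G u = real_of_ereal (g u)"
definition \<Phi> :: "'a \<Rightarrow> real" where "\<Phi> u = h u + G u"
definition \<Lambda> :: "nat \<Rightarrow> real" where "\<Lambda> k = L k (J k)"
definition Y :: "nat \<Rightarrow> 'a" where "Y k = y k (J k)"
definition V :: "nat \<Rightarrow> 'a" where "V k = residual h g q (x k) (\<Lambda> k) (Y k)"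
definition P :: "nat \<Rightarrow> 'a" where "P k = Y k - V k"
definition D :: "nat \<Rightarrow> real" where "D k = norm (Y k - x k)"

lemma open_U: "open U"
  and dom_U: "closure (edom g) \<subseteq> U"
  and C2: "C2_on U h"
  and proper_g: "proper g" and lsc_g: "lsc g" and convex_g: "econvex g"
  using A1 by (auto simp: assumption_A1_def eC2_on_def h_def[abs_def])

lemma f_real: "u \<in> U \<Longrightarrow> f u = ereal (h u)"
  using A1 by (auto simp: assumption_A1_def eC2_on_def h_def ereal_real)

lemma edom_U: "u \<in> edom g \<Longrightarrow> u \<in> U"
  using dom_U closure_subset by blast

lemma g_real: "u \<in> edom g \<Longrightarrow> g u = ereal (G u)"
  unfolding G_def by (rule proper_edom_real[OF proper_g])

lemma F_real: "u \<in> edom g \<Longrightarrow> f u + g u = ereal (\<Phi> u)"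
  by (simp add: f_real[OF edom_U] g_real \<Phi>_def)

lemma Phi_bounded_below: "\<exists>m. \<forall>u\<in>edom g. m \<le> \<Phi> u"
proof -
  obtain m :: real where m: "\<And>u. ereal m \<le> f u + g u" using A1 by (auto simp: assumption_A1_def)
  have "m \<le> \<Phi> u" if "u \<in> edom g" for u using m[of u] F_real[OF that] by simp
  then show ?thesis by blast
qed

lemma run_L0: "Lm \<le> L k 0" "L k 0 \<le> LM"
  and run_inexact: "j \<le> J k \<Longrightarrow> inexact_sol h g q \<rho> (x k) (L k j) (y k j)"
  and run_reject: "j < J k \<Longrightarrow> \<not> sufficient_decrease (\<lambda>u. f u + g u) q \<sigma> (x k) (L k j) (y k j)"
  and run_increase: "j < J k \<Longrightarrow> L k (Suc j) = \<tau> * L k j"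
  and run_accept: "sufficient_decrease (\<lambda>u. f u + g u) q \<sigma> (x k) (\<Lambda> k) (Y k)"
  and run_next: "x (Suc k) = (if f (Y k) + g (Y k) < f (P k) + g (P k) then Y k else P k)"
  and run_init: "x 0 \<in> edom g"
  using run unfolding algorithm_run_def h_def[abs_def, symmetric]
  by (auto simp: Let_def \<Lambda>_def Y_def P_def V_def)

lemma L_ge: "j \<le> J k \<Longrightarrow> Lm \<le> L k j"
proof (induction j)
  case (Suc j)
  then have j: "Lm \<le> L k j" "L k (Suc j) = \<tau> * L k j" using run_increase by auto
  have "1 * L k j \<le> \<tau> * L k j" using tau j(1) Lm by (intro mult_right_mono) auto
  then show ?case using j by simp
qed (simp add: run_L0)

lemma Lambda_ge: "Lm \<le> \<Lambda> k" and Lambda_pos: "0 < \<Lambda> k"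
  using L_ge[of "J k" k] Lm by (auto simp: \<Lambda>_def)

lemma P_prox: "P k = prox g (Y k - grad (reg_model h q (x k) (\<Lambda> k)) (Y k))"
  by (simp add: P_def V_def residual_def)

lemma P_dom: "P k \<in> edom g"
  unfolding P_prox by (rule prox_subgradient(1)[OF proper_g lsc_g convex_g])

lemma trial_dom:
  assumes "x k \<in> edom g" "j \<le> J k"
  shows "y k j \<in> edom g"
proof (rule ccontr)
  assume "y k j \<notin> edom g"
  then have "g (y k j) = \<infinity>" by (simp add: edom_def)
  then have "g (x k) = \<infinity>" using run_inexact[OF assms(2)] by (cases "g (x k)") (auto simp: inexact_sol_def)
  then show False using assms(1) by (simp add: edom_def)
qed

lemma x_dom: "x k \<in> edom g"
proof (induction k)
  case (Suc k)
  then show ?case using P_dom trial_dom[of k "J k"] by (simp add: run_next Y_def)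
qed (rule run_init)

lemma y_dom: "j \<le> J k \<Longrightarrow> y k j \<in> edom g"
  using trial_dom x_dom by blast

lemma Y_dom: "Y k \<in> edom g"
  by (simp add: Y_def y_dom)

lemma sufficient_decrease_real:
  assumes "u \<in> edom g"
  shows "sufficient_decrease (\<lambda>u. f u + g u) q \<sigma> (x k) M u \<longleftrightarrow>
     \<Phi> u \<le> \<Phi> (x k) - \<sigma> * M / q * norm (u - x k) powr q"
  by (simp add: sufficient_decrease_def F_real assms x_dom)

lemma next_le: "\<Phi> (x (Suc k)) \<le> \<Phi> (Y k)" "\<Phi> (x (Suc k)) \<le> \<Phi> (P k)"
  by (auto simp: run_next F_real Y_dom P_dom)

lemma descent: "\<sigma> * Lm / q * D k powr q \<le> \<Phi> (x k) - \<Phi> (x (Suc k))"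
proof -
  have "\<sigma> * Lm / q * D k powr q \<le> \<sigma> * \<Lambda> k / q * D k powr q"
    using Lambda_ge[of k] sigma q by (intro mult_right_mono divide_right_mono mult_left_mono) auto
  also have "\<dots> \<le> \<Phi> (x k) - \<Phi> (Y k)"
    using run_accept[of k] unfolding sufficient_decrease_real[OF Y_dom] by (simp add: D_def)
  finally show ?thesis using next_le(1)[of k] by simp
qed

lemma D_nonneg: "0 \<le> D k"
  by (simp add: D_def)

lemma descent_const_pos: "0 < \<sigma> * Lm / q"
  using sigma Lm q by simp

lemma Phi_decseq: "decseq (\<lambda>k. \<Phi> (x k))"
proof (rule decseq_SucI)
  fix k
  have "0 \<le> \<sigma> * Lm / q * D k powr q" using descent_const_pos by (intro mult_nonneg_nonneg) auto
  then show "\<Phi> (x (Suc k)) \<le> \<Phi> (x k)" using descent[of k] by simp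
qed

lemma Phi_convergent: "\<exists>l. (\<lambda>k. \<Phi> (x k)) \<longlonglongrightarrow> l \<and> (\<forall>k. l \<le> \<Phi> (x k))"
proof -
  obtain m where m: "\<forall>k. m \<le> \<Phi> (x k)" using Phi_bounded_below x_dom by metis
  from decseq_convergent[OF Phi_decseq m] show ?thesis by metis
qed

lemma D_tendsto_0: "D \<longlonglongrightarrow> 0"
proof -
  let ?c = "\<sigma> * Lm / q"
  obtain l where l: "(\<lambda>k. \<Phi> (x k)) \<longlonglongrightarrow> l" using Phi_convergent by metis
  have "(\<lambda>k. (\<Phi> (x k) - \<Phi> (x (Suc k))) / ?c) \<longlonglongrightarrow> (l - l) / ?c"
    using less_imp_neq[OF descent_const_pos, symmetric] by (intro tendsto_intros l LIMSEQ_Suc[OF l])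
  then have lim: "(\<lambda>k. (\<Phi> (x k) - \<Phi> (x (Suc k))) / ?c) \<longlonglongrightarrow> 0" by simp
  have le: "D k powr q \<le> (\<Phi> (x k) - \<Phi> (x (Suc k))) / ?c" for k
    using descent[of k] descent_const_pos by (subst pos_le_divide_eq) (simp_all add: mult.commute)
  have "(\<lambda>k. D k powr q) \<longlonglongrightarrow> 0"
    by (rule tendsto_sandwich[OF _ _ tendsto_const lim]) (intro always_eventually allI le powr_ge_zero)+
  then have "(\<lambda>k. (D k powr q) powr (1 / q)) \<longlonglongrightarrow> 0"
    by (rule tendsto_zero_powrI[where b = "1/q"]) (use q in auto)
  moreover have "(D k powr q) powr (1 / q) = D k" for k
    using q D_nonneg[of k] by (simp add: powr_powr)
  ultimately show ?thesis by simp
qed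

section \<open>Boundedness of the regularization coefficients\<close>

lemma bounded_x: "bounded (range x)"
  using A2 by (simp add: assumption_A2_def)

text \<open>The closure of the iterates is compact and, as a subset of the closure of the domain of \<open>g\<close>, still
  inside the set where \<open>f\<close> is smooth.\<close>

lemma data_bounded:
  "\<exists>C\<ge>0. \<forall>k. \<bar>h (x k)\<bar> \<le> C \<and> norm (grad h (x k)) \<le> C \<and> norm (hess h (x k)) \<le> C \<and> norm (x k) \<le> C"
proof -
  let ?K = "closure (range x)"
  have K: "compact ?K" using bounded_x by (simp add: compact_closure)
  have "range x \<subseteq> edom g" using x_dom by blast
  then have KU: "?K \<subseteq> U" using dom_U closure_mono by blast
  have bd: "\<exists>C. \<forall>k. norm (F (x k)) \<le> C" if "\<And>z. z \<in> U \<Longrightarrow> isCont F z" for F :: "'a \<Rightarrow> 'b::real_normed_vector"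
  proof -
    have "continuous_on ?K F" using KU that by (intro continuous_at_imp_continuous_on) blast
    then have "bounded (F ` ?K)" using K compact_continuous_image compact_imp_bounded by blast
    then obtain C where C: "\<forall>v\<in>F ` ?K. norm v \<le> C" unfolding bounded_iff by (rule exE)
    have "norm (F (x k)) \<le> C" for k
      using C closure_subset[of "range x"] by (meson imageI rangeI subsetD)
    then show ?thesis by (intro exI allI)
  qed
  obtain C1 where C1: "\<And>k. norm (h (x k)) \<le> C1" using bd[OF C2_on_isCont(1)[OF open_U C2]] by metis
  obtain C2' where C2': "\<And>k. norm (grad h (x k)) \<le> C2'" using bd[OF C2_on_isCont(2)[OF open_U C2]] by metis
  obtain C3 where C3: "\<And>k. norm (hess h (x k)) \<le> C3" using bd[OF C2_on_isCont(3)[OF open_U C2]] by metis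
  obtain C4 where C4: "\<And>k. norm (x k) \<le> C4" using bounded_x unfolding bounded_iff by (metis rangeI)
  define C where "C = max C1 (max C2' (max C3 C4))"
  have "0 \<le> C" using order_trans[OF norm_ge_zero C1[of 0]] by (simp add: C_def)
  moreover have "\<bar>h (x k)\<bar> \<le> C \<and> norm (grad h (x k)) \<le> C \<and> norm (hess h (x k)) \<le> C \<and> norm (x k) \<le> C" for k
    using C1[of k] C2'[of k] C3[of k] C4[of k] by (simp add: C_def le_max_iff_disj)
  ultimately show ?thesis by blast
qed

text \<open>A trial point does not increase the model. The model changes by at most a quadratic amount apart
  from its regularization term, and \<open>g\<close> decreases at most linearly, so the regularization term
  has at most quadratic size, uniformly over all trials.\<close>

lemma trial_step_bound:
  "\<exists>C\<ge>0. \<forall>k j. j \<le> J k \<longrightarrow> L k j * norm (y k j - x k) powr q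
        \<le> C * (1 + norm (y k j - x k) + (norm (y k j - x k))\<^sup>2)"
proof -
  obtain C where C: "C \<ge> 0" "\<And>k. \<bar>h (x k)\<bar> \<le> C" "\<And>k. norm (grad h (x k)) \<le> C"
    "\<And>k. norm (hess h (x k)) \<le> C" "\<And>k. norm (x k) \<le> C" using data_bounded by metis
  obtain a b where ab: "a \<ge> 0" "b \<ge> 0" "\<And>z. ereal (- (a + b * norm z)) \<le> g z"
    using convex_linear_lower_bound[OF proper_g lsc_g convex_g] by metis
  define E where "E = C + b + a + b * C + \<bar>\<Phi> (x 0)\<bar>"
  have E: "E \<ge> 0" using C(1) ab by (simp add: E_def)
  show ?thesis
  proof (rule exI[of _ "3 * E"], intro conjI allI impI)
    show "3 * E \<ge> 0" using E by simp
    fix k j assume j: "j \<le> J k"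
    define d where "d = norm (y k j - x k)"
    have d: "d \<ge> 0" by (simp add: d_def)
    let ?u = "y k j - x k"
    have "ereal (reg_model h q (x k) (L k j) (y k j)) + g (y k j) \<le> ereal (reg_model h q (x k) (L k j) (x k)) + g (x k)"
      using run_inexact[OF j] by (simp add: inexact_sol_def)
    then have "reg_model h q (x k) (L k j) (y k j) + G (y k j) \<le> reg_model h q (x k) (L k j) (x k) + G (x k)"
      by (simp add: g_real y_dom[OF j] x_dom)
    then have 1: "L k j / q * d powr q \<le> - (grad h (x k) \<bullet> ?u) - 1/2 * (blinfun_apply (hess h (x k)) ?u \<bullet> ?u)
        + G (x k) - G (y k j)"
      by (simp add: reg_model_def taylor2_def d_def algebra_simps)
    have "\<bar>grad h (x k) \<bullet> ?u\<bar> \<le> norm (grad h (x k)) * d" unfolding d_def by (rule Cauchy_Schwarz_ineq2)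
    also have "\<dots> \<le> C * d" using C(3) d by (intro mult_right_mono)
    finally have 2: "\<bar>grad h (x k) \<bullet> ?u\<bar> \<le> C * d" .
    have "\<bar>blinfun_apply (hess h (x k)) ?u \<bullet> ?u\<bar> \<le> norm (blinfun_apply (hess h (x k)) ?u) * d"
      unfolding d_def by (rule Cauchy_Schwarz_ineq2)
    also have "\<dots> \<le> (norm (hess h (x k)) * d) * d"
      using d unfolding d_def by (intro mult_right_mono norm_blinfun)
    also have "\<dots> \<le> (C * d) * d" using C(4) d by (intro mult_right_mono)
    finally have 3: "\<bar>blinfun_apply (hess h (x k)) ?u \<bullet> ?u\<bar> \<le> C * d\<^sup>2" by (simp add: power2_eq_square mult.assoc)
    have "\<Phi> (x k) \<le> \<Phi> (x 0)" using Phi_decseq by (simp add: decseq_def)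
    then have 4: "G (x k) \<le> \<bar>\<Phi> (x 0)\<bar> + C" using C(2)[of k] by (simp add: \<Phi>_def)
    have "norm (y k j) \<le> C + d" using norm_triangle_sub[of "y k j" "x k"] C(5)[of k] by (simp add: d_def)
    then have "b * norm (y k j) \<le> b * (C + d)" using ab(2) by (rule mult_left_mono)
    moreover have "- (a + b * norm (y k j)) \<le> G (y k j)" using ab(3)[of "y k j"] by (simp add: g_real y_dom[OF j])
    ultimately have 5: "- (a + b * C + b * d) \<le> G (y k j)" by (simp add: algebra_simps)
    have Cd: "0 \<le> C * d\<^sup>2" "C * d\<^sup>2 \<le> E * d\<^sup>2" "C * d + b * d \<le> E * d"
    proof -
      show "0 \<le> C * d\<^sup>2" using C(1) by simp
      show "C * d\<^sup>2 \<le> E * d\<^sup>2" using ab C(1) by (intro mult_right_mono) (auto simp: E_def)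
      have "(C + b) * d \<le> E * d" using ab C(1) d by (intro mult_right_mono) (auto simp: E_def)
      then show "C * d + b * d \<le> E * d" by (simp add: algebra_simps)
    qed
    have "L k j / q * d powr q \<le> E * d + E * d\<^sup>2 + E"
      using 1 2 3 4 5 Cd ab(2) unfolding E_def[symmetric]
      by (simp add: E_def abs_le_iff)
    then have "L k j * d powr q \<le> q * (E * d + E * d\<^sup>2 + E)" using q by (simp add: divide_le_eq mult.commute)
    also have "\<dots> \<le> 3 * (E * d + E * d\<^sup>2 + E)" using q E d by (intro mult_right_mono add_nonneg_nonneg) auto
    finally show "L k j * norm (y k j - x k) powr q
        \<le> 3 * E * (1 + norm (y k j - x k) + (norm (y k j - x k))\<^sup>2)"
      unfolding d_def[symmetric] by (simp add: algebra_simps)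
  qed
qed

lemma hess_Lipschitz_near_accumulation_point:
  assumes "z \<in> accumulation_points x"
  shows "\<exists>e>0. \<exists>K\<ge>0. ball z e \<subseteq> U \<and>
    (\<forall>u\<in>ball z e. \<forall>v\<in>ball z e. norm (hess h u - hess h v) \<le> K * norm (u - v))"
proof -
  obtain N where N: "open N" "N \<subseteq> U" "accumulation_points x \<subseteq> N" "strictly_continuous_on N (hess h)"
    using A2 unfolding assumption_A2_def h_def[abs_def, symmetric] by metis
  have z: "z \<in> N" using assms N(3) by blast
  obtain e0 where e0: "e0 > 0" "ball z e0 \<subseteq> N" using N(1) z openE by metis
  obtain e1 K where e1: "e1 > 0" "K-lipschitz_on (ball z e1 \<inter> N) (hess h)"
    using N(4) z unfolding strictly_continuous_on_def by metis
  have sub: "ball z (min e0 e1) \<subseteq> ball z e1 \<inter> N" using e0(2) by auto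
  have K: "K \<ge> 0" using e1(2) by (rule lipschitz_on_nonneg)
  have "norm (hess h u - hess h v) \<le> K * norm (u - v)" if "u \<in> ball z (min e0 e1)" "v \<in> ball z (min e0 e1)" for u v
    using lipschitz_onD[OF e1(2), of u v] that sub by (simp add: dist_norm subset_iff)
  moreover have "ball z (min e0 e1) \<subseteq> U" using sub N(2) by blast
  moreover have "min e0 e1 > 0" using e0 e1 by simp
  ultimately show ?thesis using K by blast
qed

text \<open>For a rejected trial with a large coefficient the step is so short that the trial point stays in the
  ball where the Hessian is Lipschitz. There the Taylor remainder is of third order, hence dominated
  by the regularization term of order \<open>q \<le> 3\<close>, and the trial would have been accepted. So rejected
  coefficients are bounded, and the accepted one is either the initial one or \<open>\<tau>\<close> times a rejected one.\<close>

lemma Lambda_bounded_near_accumulation_point: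
  assumes "z \<in> accumulation_points x"
  shows "\<exists>e>0. \<exists>B. \<forall>k. x k \<in> ball z e \<longrightarrow> \<Lambda> k \<le> B"
proof -
  obtain e K where eK: "e > 0" "K \<ge> 0" "ball z e \<subseteq> U"
    "\<And>u v. u \<in> ball z e \<Longrightarrow> v \<in> ball z e \<Longrightarrow> norm (hess h u - hess h v) \<le> K * norm (u - v)"
    using hess_Lipschitz_near_accumulation_point[OF assms] by metis
  obtain C where C: "C \<ge> 0"
    "\<And>k j. j \<le> J k \<Longrightarrow> L k j * norm (y k j - x k) powr q
        \<le> C * (1 + norm (y k j - x k) + (norm (y k j - x k))\<^sup>2)"
    using trial_step_bound by metis
  \<comment> \<open>beyond these thresholds a step is shorter than \<open>1\<close>, shorter than \<open>e / 2\<close>, and acceptable\<close>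
  define T where "T = max (3 * C) (max (3 * C / (e / 2) ^ 3) (3 * K / (1 - \<sigma>)))"
  have rejected: "L k j \<le> T" if near: "x k \<in> ball z (e / 2)" and j: "j < J k" for k j
  proof (rule ccontr)
    define M where "M = L k j"
    define d where "d = norm (y k j - x k)"
    assume "\<not> L k j \<le> T"
    then have M: "3 * C < M" "3 * C / (e / 2) ^ 3 < M" "3 * K / (1 - \<sigma>) < M" by (auto simp: M_def T_def)
    have d: "0 \<le> d" by (simp add: d_def)
    have jJ: "j \<le> J k" using j by simp
    have Mpos: "0 < M" using M(1) C(1) by simp
    have small: "d < 1" "M * d ^ 3 \<le> 3 * C"
      using large_coefficient_small_step[OF q d C(1) M(1)] C(2)[OF jJ] by (simp_all add: M_def d_def)
    \<comment> \<open>the step is shorter than \<open>e / 2\<close>, so the trial point remains in \<open>ball z e\<close>\<close>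
    have "3 * C < M * (e / 2) ^ 3" using M(2) eK(1) by (simp add: pos_divide_less_eq)
    then have "M * d ^ 3 < M * (e / 2) ^ 3" using small by simp
    then have "d ^ 3 < (e / 2) ^ 3" using Mpos by simp
    then have de: "d < e / 2" using eK(1) by (rule_tac power_less_imp_less_base[of _ 3]) auto
    have xz: "x k \<in> ball z e" using near eK(1) by simp
    have yz: "y k j \<in> ball z e"
      using near de dist_triangle[of z "y k j" "x k"] by (simp add: d_def dist_norm norm_minus_commute)
    have "\<not> \<Phi> (y k j) \<le> \<Phi> (x k) - \<sigma> * M / q * d powr q"
      using run_reject[OF j] unfolding sufficient_decrease_real[OF y_dom[OF jJ]] by (simp add: M_def d_def)
    moreover have "reg_model h q (x k) M (y k j) + G (y k j) \<le> h (x k) + G (x k)"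
    proof -
      have "ereal (reg_model h q (x k) M (y k j)) + g (y k j) \<le> ereal (reg_model h q (x k) M (x k)) + g (x k)"
        using run_inexact[OF jJ] by (simp add: inexact_sol_def M_def)
      then show ?thesis by (simp add: g_real y_dom[OF jJ] x_dom reg_model_def taylor2_def)
    qed
    ultimately have "M / q * d powr q - \<sigma> * M / q * d powr q < h (y k j) - taylor2 h (x k) (y k j)"
      by (simp add: \<Phi>_def reg_model_def d_def)
    also have "\<dots> \<le> K * d ^ 3"
      using taylor2_error(1)[OF open_U C2 eK(3) xz yz eK(2)] eK(4) xz unfolding d_def by fastforce
    finally have lt: "(1 - \<sigma>) * M / q * d powr q < K * d ^ 3" by (simp add: algebra_simps diff_divide_distrib)
    have d0: "d > 0" using lt d by (cases "d = 0") auto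
    have "d ^ 3 = d powr 3" using d0 by simp
    also have "\<dots> \<le> d powr q" using d0 small q by (intro powr_mono') auto
    finally have "K * d ^ 3 \<le> K * d powr q" using eK(2) by (intro mult_left_mono)
    with lt have "(1 - \<sigma>) * M / q * d powr q < K * d powr q" by linarith
    then have "(1 - \<sigma>) * M / q < K"
      by (rule mult_right_less_imp_less) simp
    then have "(1 - \<sigma>) * M < K * q" using q by (simp add: pos_divide_less_eq)
    also have "\<dots> \<le> K * 3" using q eK(2) by (intro mult_left_mono) auto
    finally have "M < 3 * K / (1 - \<sigma>)" using sigma by (simp add: pos_less_divide_eq mult.commute)
    then show False using M(3) by simp
  qed
  have "\<Lambda> k \<le> max LM (\<tau> * T)" if near: "x k \<in> ball z (e / 2)" for k
  proof (cases "J k")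
    case 0
    then show ?thesis using run_L0(2)[of k] by (simp add: \<Lambda>_def)
  next
    case (Suc j)
    then have "\<Lambda> k = \<tau> * L k j" using run_increase[of j k] by (simp add: \<Lambda>_def)
    also have "\<dots> \<le> \<tau> * T" using rejected[OF near, of j] Suc tau by (intro mult_left_mono) auto
    finally show ?thesis by simp
  qed
  then show ?thesis using eK(1) by (intro exI[of _ "e / 2"] conjI exI[of _ "max LM (\<tau> * T)"]) auto
qed

text \<open>Coefficients tending to infinity along some indices would do so along a subsequence on which the
  iterates converge, contradicting the bound near the limit.\<close>

lemma Lambda_bounded: "\<exists>B. \<forall>k. \<Lambda> k \<le> B"
proof (rule ccontr)
  assume unbdd: "\<nexists>B. \<forall>k. \<Lambda> k \<le> B"
  have ex: "\<exists>k>m. \<Lambda> k > real n" for m n :: nat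
  proof (rule ccontr)
    assume "\<not> (\<exists>k>m. \<Lambda> k > real n)"
    then have *: "\<Lambda> k \<le> real n" if "k > m" for k using that by (meson not_le)
    have "\<Lambda> k \<le> max (real n) (Max (\<Lambda> ` {..m}))" for k
    proof (cases "k > m")
      case False
      then have "\<Lambda> k \<le> Max (\<Lambda> ` {..m})" by (intro Max_ge) auto
      then show ?thesis by simp
    qed (use * in \<open>simp add: le_max_iff_disj\<close>)
    then show False using unbdd by blast
  qed
  have "\<exists>r. \<forall>n. \<Lambda> (r n) > real n \<and> r n < r (Suc n)"
  proof (rule dependent_nat_choice)
    show "\<exists>k. real 0 < \<Lambda> k" using ex[where m = 0 and n = 0] by blast
    show "\<exists>j. real (Suc n) < \<Lambda> j \<and> k < j" for k n using ex[where m = k and n = "Suc n"] by blast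
  qed
  then obtain r :: "nat \<Rightarrow> nat" where r: "\<And>n. \<Lambda> (r n) > real n" "\<And>n. r n < r (Suc n)" by metis
  have mono_r: "strict_mono r" using r(2) by (simp add: strict_mono_Suc_iff)
  have "bounded (range (x \<circ> r))" using bounded_x by (rule bounded_subset) auto
  then obtain z s where s: "strict_mono (s :: nat \<Rightarrow> nat)" "((x \<circ> r) \<circ> s) \<longlonglongrightarrow> z"
    using bounded_imp_convergent_subsequence by metis
  have "z \<in> accumulation_points x"
    using s strict_mono_o[OF mono_r s(1)] by (auto simp: accumulation_points_def o_assoc intro!: exI[of _ "r \<circ> s"])
  then obtain e B where e: "e > 0" "\<And>k. x k \<in> ball z e \<Longrightarrow> \<Lambda> k \<le> B"
    using Lambda_bounded_near_accumulation_point by metis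
  have "eventually (\<lambda>n. dist (x (r (s n))) z < e) sequentially"
    using tendstoD[OF s(2) e(1)] by simp
  moreover have "eventually (\<lambda>n. n \<ge> nat \<lceil>B\<rceil>) sequentially" by (rule eventually_ge_at_top)
  ultimately have "eventually (\<lambda>n. False) sequentially"
  proof eventually_elim
    case (elim n)
    have "\<Lambda> (r (s n)) \<le> B" using elim(1) by (intro e(2)) (simp add: dist_commute)
    moreover have "real (s n) < \<Lambda> (r (s n))" by (rule r)
    moreover have "n \<le> s n" using s(1) by (rule strict_mono_imp_increasing)
    ultimately show False using elim(2) by linarith
  qed
  then show False by simp
qed

lemma D_bounded: "\<exists>E\<ge>1. \<forall>k. D k \<le> E"
proof -
  have "Bseq D" using D_tendsto_0 convergent_imp_Bseq convergentI by blast
  then obtain E where "\<And>k. norm (D k) \<le> E" by (metis BseqD)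
  then have "\<And>k. D k \<le> max 1 E" by (metis abs_ge_self le_max_iff_disj order_trans real_norm_def)
  then show ?thesis by (meson max.cobounded1)
qed

text \<open>The steps are bounded and \<open>q \<ge> 2\<close>, so the power \<open>q - 1\<close> is linearly dominated.\<close>

lemma regularization_le: "\<exists>A\<ge>0. \<forall>k. \<Lambda> k * D k powr (q - 1) \<le> A * D k"
proof -
  obtain B where B: "\<And>k. \<Lambda> k \<le> B" using Lambda_bounded by metis
  obtain E where E: "E \<ge> 1" "\<And>k. D k \<le> E" using D_bounded by metis
  have B0: "B \<ge> 0" using B[of 0] Lambda_pos[of 0] by simp
  have "\<Lambda> k * D k powr (q - 1) \<le> (B * E) * D k" for k
  proof -
    have "D k powr (q - 1) = D k powr (q - 2) * D k"
      using powr_add[of "D k" "q - 2" 1] D_nonneg[of k] by simp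
    also have "\<dots> \<le> E powr 1 * D k"
    proof (intro mult_right_mono D_nonneg)
      have "D k powr (q - 2) \<le> E powr (q - 2)" using q E D_nonneg by (intro powr_mono2) auto
      also have "\<dots> \<le> E powr 1" using q E by (intro powr_mono) auto
      finally show "D k powr (q - 2) \<le> E powr 1" .
    qed
    finally have "D k powr (q - 1) \<le> E * D k" using E by simp
    then have "\<Lambda> k * D k powr (q - 1) \<le> B * (E * D k)"
      using B[of k] Lambda_pos[of k] B0 by (intro mult_mono) auto
    then show ?thesis by (simp add: mult.assoc)
  qed
  moreover have "B * E \<ge> 0" using B0 E by simp
  ultimately show ?thesis by blast
qed

lemma V_le: "norm (V k) \<le> \<Lambda> k * D k powr (q - 1)"
proof -
  have "norm (V k) \<le> \<rho> * \<Lambda> k * D k powr (q - 1)"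
    using run_inexact[of "J k" k] by (simp add: inexact_sol_def V_def Y_def D_def \<Lambda>_def)
  also have "\<dots> \<le> 1 * \<Lambda> k * D k powr (q - 1)"
    using rho Lambda_pos[of k] by (intro mult_right_mono) auto
  finally show ?thesis by simp
qed

section \<open>Subgradients at the proximal points\<close>

text \<open>The subgradient of \<open>g\<close> at \<open>P k\<close> given by the optimality condition of the proximal problem.\<close>

definition \<xi> :: "nat \<Rightarrow> 'a" where "\<xi> k = V k - grad (reg_model h q (x k) (\<Lambda> k)) (Y k)"

lemma subgradient_at_P: "G (P k) + \<xi> k \<bullet> (z - P k) \<le> G z" if "z \<in> edom g"
proof -
  have "Y k - grad (reg_model h q (x k) (\<Lambda> k)) (Y k) - P k = \<xi> k" by (simp add: \<xi>_def P_def)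
  then have "g (P k) + ereal (\<xi> k \<bullet> (z - P k)) \<le> g z"
    using prox_subgradient(2)[OF proper_g lsc_g convex_g, of "Y k - grad (reg_model h q (x k) (\<Lambda> k)) (Y k)" z]
    unfolding P_prox[symmetric] by simp
  then show ?thesis by (simp add: g_real P_dom that)
qed

lemma F_subgradient_at_P: "grad h (P k) + \<xi> k \<in> regular_subdiff (\<lambda>u. f u + g u) (P k)"
proof (rule regular_subdiff_sum[OF open_U])
  show PU: "P k \<in> U" by (intro edom_U P_dom)
  show "GDERIV h (P k) :> grad h (P k)" by (rule C2_on_GDERIV[OF C2 PU])
  show "\<bar>g (P k)\<bar> \<noteq> \<infinity>" by (simp add: g_real P_dom)
  show "g (P k) + ereal (\<xi> k \<bullet> (z - P k)) \<le> g z" for z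
  proof (cases "z \<in> edom g")
    case True
    then show ?thesis using subgradient_at_P by (simp add: g_real P_dom)
  next
    case False
    then show ?thesis by (simp add: edom_def)
  qed
qed (rule f_real)

lemma xi_decomposition:
  obtains u where "norm u \<le> \<Lambda> k * D k powr (q - 1)"
    "\<xi> k = V k - grad h (x k) - blinfun_apply (hess h (x k)) (Y k - x k) - u"
proof -
  let ?u = "(\<Lambda> k * D k powr (q - 2)) *\<^sub>R (Y k - x k)"
  have "norm ?u = \<Lambda> k * (D k powr (q - 2) * D k)"
    using Lambda_pos[of k] by (simp add: D_def)
  also have "D k powr (q - 2) * D k = D k powr (q - 1)"
    using powr_add[of "D k" "q - 2" 1] D_nonneg[of k] by simp
  finally have "norm ?u \<le> \<Lambda> k * D k powr (q - 1)" by simp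
  moreover have "\<xi> k = V k - grad h (x k) - blinfun_apply (hess h (x k)) (Y k - x k) - ?u"
    unfolding \<xi>_def grad_reg_model[OF open_U C2 edom_U[OF x_dom] q(1)] D_def by simp
  ultimately show thesis by (rule that)
qed

lemma V_le_D: "\<exists>A\<ge>0. \<forall>k. norm (V k) \<le> A * D k"
  using regularization_le V_le by (meson order_trans)

lemma xi_bounded: "\<exists>C\<ge>0. \<forall>k. norm (\<xi> k) \<le> C"
proof -
  obtain C where C: "C \<ge> 0" "\<And>k. \<bar>h (x k)\<bar> \<le> C" "\<And>k. norm (grad h (x k)) \<le> C"
    "\<And>k. norm (hess h (x k)) \<le> C" "\<And>k. norm (x k) \<le> C" using data_bounded by metis
  obtain A where A: "A \<ge> 0" "\<And>k. \<Lambda> k * D k powr (q - 1) \<le> A * D k" using regularization_le by metis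
  obtain E where E: "E \<ge> 1" "\<And>k. D k \<le> E" using D_bounded by metis
  have "norm (\<xi> k) \<le> A * E + C + C * E + A * E" for k
  proof -
    obtain u where u: "norm u \<le> \<Lambda> k * D k powr (q - 1)"
      "\<xi> k = V k - grad h (x k) - blinfun_apply (hess h (x k)) (Y k - x k) - u"
      by (rule xi_decomposition)
    have AE: "A * D k \<le> A * E" using A(1) E(2) by (intro mult_left_mono)
    have "norm (blinfun_apply (hess h (x k)) (Y k - x k)) \<le> norm (hess h (x k)) * D k"
      unfolding D_def by (rule norm_blinfun)
    also have "\<dots> \<le> C * E" using C(1,4) E(2) D_nonneg by (intro mult_mono) auto
    finally have H: "norm (blinfun_apply (hess h (x k)) (Y k - x k)) \<le> C * E" .
    have "norm (\<xi> k) \<le> norm (V k) + norm (grad h (x k)) + norm (blinfun_apply (hess h (x k)) (Y k - x k)) + norm u"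
      unfolding u(2) by (intro order_trans[OF norm_triangle_ineq4] add_mono order_refl)
    then show ?thesis using V_le[of k] A(2)[of k] AE u(1) C(3)[of k] H by linarith
  qed
  moreover have "A * E + C + C * E + A * E \<ge> 0" using A C E by simp
  ultimately show ?thesis by blast
qed

lemma P_minus_x: "(\<lambda>k. P k - x k) \<longlonglongrightarrow> 0" and V_tendsto_0: "V \<longlonglongrightarrow> 0"
proof -
  obtain A where A: "\<And>k. norm (V k) \<le> A * D k" using V_le_D by metis
  have "(\<lambda>k. A * D k) \<longlonglongrightarrow> 0" using tendsto_mult_left[OF D_tendsto_0, of A] by simp
  then show V: "V \<longlonglongrightarrow> 0" by (rule Lim_null_comparison[rotated]) (intro always_eventually allI A)
  have "(\<lambda>k. Y k - x k) \<longlonglongrightarrow> 0"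
    using D_tendsto_0 unfolding D_def[abs_def] by (rule tendsto_norm_zero_cancel)
  from tendsto_diff[OF this V] show "(\<lambda>k. P k - x k) \<longlonglongrightarrow> 0" by (simp add: P_def algebra_simps)
qed

lemma next_step_le: "\<exists>A\<ge>0. \<forall>k. norm (x (Suc k) - x k) \<le> A * D k"
proof -
  obtain A where A: "A \<ge> 0" "\<And>k. norm (V k) \<le> A * D k" using V_le_D by metis
  have "norm (x (Suc k) - x k) \<le> (1 + A) * D k" for k
  proof (cases "x (Suc k) = Y k")
    case True
    then show ?thesis using A(1) D_nonneg[of k] by (simp add: D_def algebra_simps)
  next
    case False
    then have "x (Suc k) - x k = (Y k - x k) - V k" by (simp add: run_next P_def split: if_splits)
    then have "norm (x (Suc k) - x k) \<le> D k + norm (V k)"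
      unfolding D_def using norm_triangle_ineq4 by metis
    then show ?thesis using A(2)[of k] by (simp add: algebra_simps)
  qed
  then show ?thesis using A(1) by (intro exI[of _ "1 + A"]) simp
qed

lemma Phi_P_le:
  "\<exists>C\<ge>0. \<forall>k. \<forall>z\<in>edom g. \<Phi> (P k) \<le> h (P k) + G z + C * norm (z - P k)"
proof -
  obtain C where C: "C \<ge> 0" "\<And>k. norm (\<xi> k) \<le> C" using xi_bounded by metis
  have "\<Phi> (P k) \<le> h (P k) + G z + C * norm (z - P k)" if "z \<in> edom g" for k z
  proof -
    have "- (\<xi> k \<bullet> (z - P k)) \<le> norm (\<xi> k) * norm (z - P k)"
      using Cauchy_Schwarz_ineq2[of "\<xi> k" "z - P k"] by linarith
    also have "\<dots> \<le> C * norm (z - P k)" using C by (intro mult_right_mono) auto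
    finally show ?thesis using subgradient_at_P[OF that, of k] by (simp add: \<Phi>_def)
  qed
  then show ?thesis using C(1) by blast
qed

text \<open>Lower semicontinuity bounds the value at the accumulation point from above by the limit of the
  objective values. Conversely, the subgradient inequality at \<open>P k\<close>, evaluated at \<open>xb\<close>, bounds the
  objective at \<open>P k\<close> by its value at \<open>xb\<close> up to a vanishing error, because the subgradients are bounded;
  and the objective at the next iterate is not larger than at \<open>P k\<close>.\<close>

lemma accumulation_point_value:
  assumes r: "strict_mono (r :: nat \<Rightarrow> nat)" "(\<lambda>n. x (r n)) \<longlonglongrightarrow> xb"
  shows "xb \<in> edom g" "(\<lambda>k. \<Phi> (x k)) \<longlonglongrightarrow> \<Phi> xb" "(\<lambda>n. \<Phi> (P (r n))) \<longlonglongrightarrow> \<Phi> xb"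
proof -
  obtain l where l: "(\<lambda>k. \<Phi> (x k)) \<longlonglongrightarrow> l" "\<And>k. l \<le> \<Phi> (x k)" using Phi_convergent by metis
  have "xb \<in> closure (edom g)"
    unfolding closure_sequential using x_dom r(2) by (intro exI[of _ "\<lambda>n. x (r n)"]) auto
  then have xU: "xb \<in> U" using dom_U by blast
  note conth = C2_on_isCont(1)[OF open_U C2 xU]
  have hx: "(\<lambda>n. h (x (r n))) \<longlonglongrightarrow> h xb" by (rule isCont_tendsto_compose[OF conth r(2)])
  have "(\<lambda>n. \<Phi> (x (r n))) \<longlonglongrightarrow> l" using LIMSEQ_subseq_LIMSEQ[OF l(1) r(1)] by (simp add: o_def)
  from tendsto_diff[OF this hx] have Gx: "(\<lambda>n. G (x (r n))) \<longlonglongrightarrow> l - h xb" by (simp add: \<Phi>_def)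
  have le: "g xb \<le> ereal (l - h xb)"
  proof (rule ccontr)
    assume "\<not> g xb \<le> ereal (l - h xb)"
    then obtain c where c: "ereal (l - h xb) < ereal c" "ereal c < g xb"
      using ereal_dense2[of "ereal (l - h xb)" "g xb"] by (auto simp: not_le)
    have "eventually (\<lambda>n. ereal c < g (x (r n))) sequentially"
      by (rule eventually_compose_filterlim[OF lsc_eventually_less[OF lsc_g c(2)] r(2)])
    then have "eventually (\<lambda>n. c \<le> G (x (r n))) sequentially"
      by eventually_elim (simp add: g_real x_dom)
    then have "c \<le> l - h xb" by (intro tendsto_lowerbound[OF Gx]) simp_all
    then show False using c(1) by simp
  qed
  then show dom: "xb \<in> edom g" by (auto simp: edom_def)
  then have lower: "\<Phi> xb \<le> l" using le by (simp add: g_real \<Phi>_def)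
  have "(\<lambda>n. P (r n) - x (r n)) \<longlonglongrightarrow> 0"
    using LIMSEQ_subseq_LIMSEQ[OF P_minus_x r(1)] by (simp add: o_def)
  from tendsto_add[OF this r(2)] have Pr: "(\<lambda>n. P (r n)) \<longlonglongrightarrow> xb" by simp
  obtain C where C: "\<And>k z. z \<in> edom g \<Longrightarrow> \<Phi> (P k) \<le> h (P k) + G z + C * norm (z - P k)"
    using Phi_P_le by metis
  let ?up = "\<lambda>n. h (P (r n)) + G xb + C * norm (xb - P (r n))"
  have up: "\<Phi> (P (r n)) \<le> ?up n" for n using C[OF dom] .
  have "?up \<longlonglongrightarrow> h xb + G xb + C * norm (xb - xb)"
    by (intro tendsto_intros isCont_tendsto_compose[OF conth] Pr)
  then have uplim: "?up \<longlonglongrightarrow> \<Phi> xb" by (simp add: \<Phi>_def)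
  have lowP: "l \<le> \<Phi> (P k)" for k using l(2)[of "Suc k"] next_le(2)[of k] by simp
  have "l \<le> \<Phi> xb"
    by (rule tendsto_lowerbound[OF uplim]) (use order_trans[OF lowP up] in auto)
  with lower have eq: "l = \<Phi> xb" by simp
  show "(\<lambda>k. \<Phi> (x k)) \<longlonglongrightarrow> \<Phi> xb" using l(1) eq by simp
  show "(\<lambda>n. \<Phi> (P (r n))) \<longlonglongrightarrow> \<Phi> xb"
    by (rule tendsto_sandwich[OF _ _ tendsto_const uplim]) (use lowP up eq in auto)
qed

text \<open>The residual and the gradient of the regularization term have size at most
  \<open>\<Lambda> k * D k powr (q - 1)\<close> each; the other two terms are the change of the gradient between \<open>Y k\<close>
  and \<open>P k\<close> and the linearization error of the gradient.\<close>

lemma F_subgradient_estimate: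
  "norm (grad h (P k) + \<xi> k) \<le> norm (grad h (P k) - grad h (Y k))
     + norm (grad h (Y k) - grad h (x k) - blinfun_apply (hess h (x k)) (Y k - x k))
     + 2 * (\<Lambda> k * D k powr (q - 1))"
proof -
  obtain u where u: "norm u \<le> \<Lambda> k * D k powr (q - 1)"
      "\<xi> k = V k - grad h (x k) - blinfun_apply (hess h (x k)) (Y k - x k) - u"
    by (rule xi_decomposition)
  have "grad h (P k) + \<xi> k = (grad h (P k) - grad h (Y k))
     + (grad h (Y k) - grad h (x k) - blinfun_apply (hess h (x k)) (Y k - x k)) + V k - u"
    by (simp add: u(2))
  then have "norm (grad h (P k) + \<xi> k) \<le> norm (grad h (P k) - grad h (Y k))
     + norm (grad h (Y k) - grad h (x k) - blinfun_apply (hess h (x k)) (Y k - x k)) + norm (V k) + norm u"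
    by (simp only:) (intro order_trans[OF norm_triangle_ineq4] order_trans[OF norm_triangle_ineq] add_mono order_refl)
  then show ?thesis using u(1) V_le[of k] by linarith
qed

text \<open>Where the Hessian is Lipschitz, the linearization error of the gradient is of order two, and
  \<open>D k ^ 2 \<le> D k powr (q - 1)\<close> for \<open>D k \<le> 1\<close> since \<open>q \<le> 3\<close>.\<close>

lemma F_subgradient_small_near:
  assumes "z \<in> accumulation_points x"
  shows "\<exists>e>0. \<exists>B\<ge>0. ball z e \<subseteq> U \<and> (\<forall>k. x k \<in> ball z e \<longrightarrow> Y k \<in> ball z e \<longrightarrow> P k \<in> ball z e \<longrightarrow> D k \<le> 1 \<longrightarrow>
     norm (grad h (P k) + \<xi> k) \<le> B * D k powr (q - 1))"
proof -
  obtain e K where eK: "e > 0" "K \<ge> 0" "ball z e \<subseteq> U"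
    "\<And>u v. u \<in> ball z e \<Longrightarrow> v \<in> ball z e \<Longrightarrow> norm (hess h u - hess h v) \<le> K * norm (u - v)"
    using hess_Lipschitz_near_accumulation_point[OF assms] by metis
  obtain B where B: "\<And>k. \<Lambda> k \<le> B" using Lambda_bounded by metis
  have B0: "B \<ge> 0" using B[of 0] Lambda_pos[of 0] by simp
  define H where "H = norm (hess h z) + K * e"
  have H0: "H \<ge> 0" using eK by (simp add: H_def)
  have Hbd: "onorm (blinfun_apply (hess h u)) \<le> H" if u: "u \<in> ball z e" for u
  proof -
    have "norm (hess h u - hess h z) \<le> K * norm (u - z)" using eK(1) u by (intro eK(4)) auto
    also have "\<dots> \<le> K * e" using u eK(2) by (intro mult_left_mono) (auto simp: dist_norm norm_minus_commute)
    finally show ?thesis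
      using norm_triangle_sub[of "hess h u" "hess h z"] by (simp add: H_def norm_blinfun.rep_eq)
  qed
  have Glip: "norm (grad h u - grad h v) \<le> H * norm (u - v)" if "u \<in> ball z e" "v \<in> ball z e" for u v
  proof (rule differentiable_bound[OF convex_ball, where f = "grad h" and f' = "\<lambda>u. blinfun_apply (hess h u)"])
    fix w assume "w \<in> ball z e"
    then have "(grad h has_derivative blinfun_apply (hess h w)) (at w)"
      using eK(3) by (intro C2_on_hess[OF C2]) blast
    then show "(grad h has_derivative blinfun_apply (hess h w)) (at w within ball z e)"
      by (rule has_derivative_at_withinI)
  qed (use that Hbd in auto)
  have "norm (grad h (P k) + \<xi> k) \<le> (H * B + K + 2 * B) * D k powr (q - 1)"
    if near: "x k \<in> ball z e" "Y k \<in> ball z e" "P k \<in> ball z e" and D1: "D k \<le> 1" for k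
  proof -
    have reg: "\<Lambda> k * D k powr (q - 1) \<le> B * D k powr (q - 1)" using B by (intro mult_right_mono) auto
    have "norm (grad h (P k) - grad h (Y k)) \<le> H * norm (V k)"
      using Glip[OF near(3,2)] by (simp add: P_def)
    also have "\<dots> \<le> H * (B * D k powr (q - 1))"
      using V_le[of k] reg H0 by (intro mult_left_mono) auto
    finally have 1: "norm (grad h (P k) - grad h (Y k)) \<le> H * B * D k powr (q - 1)" by simp
    have "norm (grad h (Y k) - grad h (x k) - blinfun_apply (hess h (x k)) (Y k - x k)) \<le> K * (D k)\<^sup>2"
      unfolding D_def
      by (rule taylor2_error(2)[OF open_U C2 eK(3) near(1,2) eK(2)]) (use eK(4) near(1) in blast)
    also have "(D k)\<^sup>2 \<le> D k powr (q - 1)"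
    proof (cases "D k = 0")
      case False
      then have "D k powr 2 \<le> D k powr (q - 1)" using D1 q D_nonneg[of k] by (intro powr_mono') auto
      then show ?thesis using False D_nonneg[of k] by simp
    qed simp
    finally have 2: "norm (grad h (Y k) - grad h (x k) - blinfun_apply (hess h (x k)) (Y k - x k)) \<le> K * D k powr (q - 1)"
      using eK(2) by (simp add: mult_left_mono)
    show ?thesis using F_subgradient_estimate[of k] 1 2 reg by (simp add: algebra_simps)
  qed
  moreover have "H * B + K + 2 * B \<ge> 0" using H0 B0 eK(2) by simp
  ultimately show ?thesis using eK(1,3) by blast
qed

text \<open>The points \<open>P (r n)\<close> approximate \<open>xb\<close> with convergent objective values, and the subgradients
  there vanish in the limit because the gradient is continuous and the steps tend to zero.\<close>

lemma accumulation_point_stationary: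
  assumes r: "strict_mono (r :: nat \<Rightarrow> nat)" "(\<lambda>n. x (r n)) \<longlonglongrightarrow> xb"
  shows "xb \<in> stationary (\<lambda>u. f u + g u)"
proof -
  note val = accumulation_point_value[OF r]
  have xU: "xb \<in> U" using val(1) by (rule edom_U)
  have sub: "(\<lambda>n. X (r n)) \<longlonglongrightarrow> c" if "X \<longlonglongrightarrow> c" for X and c :: "'b::topological_space"
    using LIMSEQ_subseq_LIMSEQ[OF that r(1)] by (simp add: o_def)
  have Pr: "(\<lambda>n. P (r n)) \<longlonglongrightarrow> xb" using tendsto_add[OF sub[OF P_minus_x] r(2)] by simp
  have Yr: "(\<lambda>n. Y (r n)) \<longlonglongrightarrow> xb"
    using tendsto_add[OF Pr sub[OF V_tendsto_0]] by (simp add: P_def)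
  have gr: "(\<lambda>n. grad h (X n)) \<longlonglongrightarrow> grad h xb" if "X \<longlonglongrightarrow> xb" for X
    by (rule isCont_tendsto_compose[OF C2_on_isCont(2)[OF open_U C2 xU] that])
  have Hr: "(\<lambda>n. hess h (x (r n))) \<longlonglongrightarrow> hess h xb"
    by (rule isCont_tendsto_compose[OF C2_on_isCont(3)[OF open_U C2 xU] r(2)])
  obtain A where A: "A \<ge> 0" "\<And>k. \<Lambda> k * D k powr (q - 1) \<le> A * D k" using regularization_le by metis
  let ?b = "\<lambda>n. norm (grad h (P (r n)) - grad h (Y (r n)))
     + norm (grad h (Y (r n)) - grad h (x (r n)) - blinfun_apply (hess h (x (r n))) (Y (r n) - x (r n)))
     + 2 * (A * D (r n))"
  have "?b \<longlonglongrightarrow> norm (grad h xb - grad h xb) + norm (grad h xb - grad h xb - blinfun_apply (hess h xb) (xb - xb))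
     + 2 * (A * 0)"
    by (intro tendsto_intros gr Pr Yr r(2) Hr sub[OF D_tendsto_0])
  then have b: "?b \<longlonglongrightarrow> 0" by simp
  have "norm (grad h (P (r n)) + \<xi> (r n)) \<le> ?b n" for n
    using F_subgradient_estimate[of "r n"] A(2)[of "r n"] by linarith
  then have w: "(\<lambda>n. grad h (P (r n)) + \<xi> (r n)) \<longlonglongrightarrow> 0"
    by (intro Lim_null_comparison[OF always_eventually b] allI)
  show ?thesis
    unfolding stationary_def mem_Collect_eq
  proof (rule limiting_subdiffI[OF _ Pr _ F_subgradient_at_P w])
    show "\<bar>f xb + g xb\<bar> \<noteq> \<infinity>" by (simp add: F_real val(1))
    show "(\<lambda>n. f (P (r n)) + g (P (r n))) \<longlonglongrightarrow> f xb + g xb"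
      using val(3) by (simp add: F_real P_dom val(1))
  qed
qed

section \<open>Finite length and convergence\<close>

text \<open>The small subgradient lives at \<open>P k\<close>, while the decrease of the objective is measured from the
  iterate \<open>x (k + 1)\<close>, which may differ from \<open>P k\<close>. The inequality of Kurdyka and Lojasiewicz is
  therefore applied at \<open>P k\<close> and transferred: the objective at \<open>x (k + 1)\<close> is not larger than at \<open>P k\<close>, and
  the derivative of the concave desingularizing function \<open>\<phi>\<close> is decreasing. The objective at \<open>P k\<close>
  is in the admissible range, close above its value at \<open>xb\<close>, by the subgradient inequality at \<open>P k\<close>.
  Combined with the decrease in step \<open>k + 1\<close> this gives the recursion for \<open>D\<close>.\<close>

lemma finite_length:
  assumes r: "strict_mono (r :: nat \<Rightarrow> nat)" "(\<lambda>n. x (r n)) \<longlonglongrightarrow> xb"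
    and KL: "KL_at (\<lambda>u. f u + g u) xb"
  shows "summable D"
proof -
  note val = accumulation_point_value[OF r]
  have xU: "xb \<in> U" using val(1) by (rule edom_U)
  have acc: "xb \<in> accumulation_points x" using r by (auto simp: accumulation_points_def o_def)
  obtain \<delta> w \<phi> where \<delta>: "\<delta> > 0" and w: "0 < w" and \<phi>: "\<phi> \<in> KL_desing w"
    and KLineq: "\<forall>u. norm (u - xb) \<le> \<delta> \<and> f xb + g xb < f u + g u \<and> f u + g u < f xb + g xb + w \<longrightarrow>
       1 \<le> ereal (deriv \<phi> (real_of_ereal (f u + g u - (f xb + g xb)))) * edist_to 0 (limiting_subdiff (\<lambda>u. f u + g u) u)"
    using KL unfolding KL_at_def by (elim exE conjE bexE) (rule that)
  obtain w0 where w0: "0 < w0" "ereal w0 < w" using ereal_dense2[OF w] by (auto simp: zero_ereal_def)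
  define e where "e k = \<Phi> (x k) - \<Phi> xb" for k
  have e_nonneg: "0 \<le> e k" for k using decseq_ge[OF Phi_decseq val(2), of k] by (simp add: e_def)
  have e_lim: "e \<longlonglongrightarrow> 0" using tendsto_diff[OF val(2) tendsto_const[of "\<Phi> xb"]] by (simp add: e_def[abs_def])
  obtain e1 B where B: "e1 > 0" "B \<ge> 0"
    "\<And>k. x k \<in> ball xb e1 \<Longrightarrow> Y k \<in> ball xb e1 \<Longrightarrow> P k \<in> ball xb e1 \<Longrightarrow> D k \<le> 1 \<Longrightarrow>
     norm (grad h (P k) + \<xi> k) \<le> B * D k powr (q - 1)"
    using F_subgradient_small_near[OF acc] by metis
  obtain C where C: "C \<ge> 0" "\<And>k z. z \<in> edom g \<Longrightarrow> \<Phi> (P k) \<le> h (P k) + G z + C * norm (z - P k)"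
    using Phi_P_le by metis
  \<comment> \<open>in the ball of radius \<open>e2\<close> the objective at \<open>P k\<close> exceeds its value at \<open>xb\<close> by less than \<open>w0\<close>\<close>
  have "isCont (\<lambda>u. h u + C * norm (xb - u)) xb"
    by (intro continuous_intros C2_on_isCont(1)[OF open_U C2 xU])
  then obtain e2 where e2: "e2 > 0" "\<And>u. dist u xb < e2 \<Longrightarrow> dist (h u + C * norm (xb - u)) (h xb + C * norm (xb - xb)) < w0"
    using w0(1) unfolding continuous_at_eps_delta by metis
  define \<epsilon> where "\<epsilon> = min e1 (min e2 \<delta>)"
  have \<epsilon>: "\<epsilon> > 0" "\<epsilon> \<le> e1" "\<epsilon> \<le> e2" "\<epsilon> \<le> \<delta>" using B(1) e2(1) \<delta> by (auto simp: \<epsilon>_def)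
  have "eventually (\<lambda>k. D k < min 1 (\<epsilon> / 2)) sequentially"
    using \<epsilon>(1) by (intro order_tendstoD(2)[OF D_tendsto_0]) auto
  moreover have "eventually (\<lambda>k. norm (P k - x k) < \<epsilon> / 2) sequentially"
    using \<epsilon>(1) by (intro order_tendstoD(2)[OF tendsto_norm_zero[OF P_minus_x]]) auto
  moreover have "eventually (\<lambda>k. e k < w0) sequentially"
    using w0(1) by (intro order_tendstoD(2)[OF e_lim])
  ultimately have "eventually (\<lambda>k. D k < min 1 (\<epsilon> / 2) \<and> norm (P k - x k) < \<epsilon> / 2 \<and> e k < w0) sequentially"
    by eventually_elim simp
  then obtain K0 where K0: "\<And>k. k \<ge> K0 \<Longrightarrow> D k < min 1 (\<epsilon> / 2) \<and> norm (P k - x k) < \<epsilon> / 2 \<and> e k < w0"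
    unfolding eventually_sequentially by metis
  have ew: "ereal (e k) < w" if "k \<ge> K0" for k
    using K0[OF that] w0(2) by (metis ereal_less_eq(3) le_less_trans less_imp_le)
  define c where "c = \<sigma> * Lm / q"
  have c: "c > 0" using descent_const_pos by (simp add: c_def)
  have step: "D (Suc k) \<le> D k / 2 + 4 * B / c * (\<phi> (e (Suc k)) - \<phi> (e (Suc (Suc k))))"
    if k: "k \<ge> K0" and near: "norm (x k - xb) < \<epsilon> / 2" for k
  proof -
    have k1: "Suc k \<ge> K0" and k2: "Suc (Suc k) \<ge> K0" using k by auto
    have drop: "c * D (Suc k) powr q \<le> e (Suc k) - e (Suc (Suc k))"
      using descent[of "Suc k"] by (simp add: c_def e_def)
    show ?thesis
    \<comment> \<open>if the limit value is reached, the inequality of Kurdyka and Lojasiewicz is void,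
      but the steps vanish\<close>
    proof (cases "e (Suc k) = 0")
      case True
      have "0 \<le> c * D (Suc k) powr q" using c by simp
      then have "e (Suc (Suc k)) = 0" using drop e_nonneg[of "Suc (Suc k)"] True by linarith
      moreover have "D (Suc k) = 0"
      proof -
        have "c * D (Suc k) powr q \<le> 0" using drop True e_nonneg[of "Suc (Suc k)"] by linarith
        then have "D (Suc k) powr q \<le> 0" using c by (simp add: mult_le_0_iff)
        then show ?thesis by (metis less_le not_le powr_eq_0_iff powr_ge_zero)
      qed
      ultimately show ?thesis using True D_nonneg[of k] by simp
    next
      case False
      then have pos: "e (Suc k) > 0" using e_nonneg[of "Suc k"] by simp
      have Dk: "D k \<le> 1" "D k < \<epsilon> / 2" and Pk: "norm (P k - x k) < \<epsilon> / 2" using K0[OF k] by auto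
      have xk: "x k \<in> ball xb \<epsilon>" using near \<epsilon>(1) by (simp add: dist_norm norm_minus_commute)
      have Yk: "Y k \<in> ball xb \<epsilon>"
        using norm_triangle_lt[of "Y k - x k" "x k - xb" \<epsilon>] near Dk(2)
        by (simp add: D_def dist_norm norm_minus_commute)
      have Pkb: "P k \<in> ball xb \<epsilon>"
        using norm_triangle_lt[of "P k - x k" "x k - xb" \<epsilon>] near Pk
        by (simp add: dist_norm norm_minus_commute)
      define a where "a = \<Phi> (P k) - \<Phi> xb"
      have a_ge: "e (Suc k) \<le> a" using next_le(2)[of k] by (simp add: a_def e_def)
      have "dist (h (P k) + C * norm (xb - P k)) (h xb + C * norm (xb - xb)) < w0"
        using Pkb \<epsilon>(3) by (intro e2(2)) (simp add: dist_commute)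
      then have a_lt: "a < w0"
        using C(2)[OF val(1), of k] by (simp add: a_def \<Phi>_def dist_real_def abs_less_iff)
      then have aw: "ereal a < w" using w0(2) by (metis ereal_less_eq(3) le_less_trans less_imp_le)
      have a_pos: "a > 0" using a_ge pos by simp
      have F: "f (P k) + g (P k) = ereal (\<Phi> xb + a)" "f xb + g xb = ereal (\<Phi> xb)"
        by (simp_all add: F_real P_dom val(1) a_def)
      let ?v = "grad h (P k) + \<xi> k"
      have \<phi>'pos: "0 < deriv \<phi> a" using \<phi> a_pos aw by (simp add: KL_desing_def)
      have "1 \<le> ereal (deriv \<phi> (real_of_ereal (f (P k) + g (P k) - (f xb + g xb))))
          * edist_to 0 (limiting_subdiff (\<lambda>u. f u + g u) (P k))"
      proof (rule KLineq[rule_format], intro conjI)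
        show "norm (P k - xb) \<le> \<delta>" using Pkb \<epsilon>(4) by (simp add: dist_norm norm_minus_commute)
        show "f xb + g xb < f (P k) + g (P k)" using a_pos by (simp add: F)
        show "f (P k) + g (P k) < f xb + g xb + w" using aw by (cases w) (auto simp: F)
      qed
      also have "f (P k) + g (P k) - (f xb + g xb) = ereal a" by (simp add: F)
      also have "ereal (deriv \<phi> (real_of_ereal (ereal a))) * edist_to 0 (limiting_subdiff (\<lambda>u. f u + g u) (P k))
          \<le> ereal (deriv \<phi> a) * ereal (norm ?v)"
        using \<phi>'pos F_subgradient_at_P[of k] regular_subset_limiting_subdiff
        by (simp del: times_ereal.simps) (intro ereal_mult_left_mono edist_to_le, auto)
      finally have "1 \<le> deriv \<phi> a * norm ?v" by (simp add: one_ereal_def)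
      also have "\<dots> \<le> deriv \<phi> (e (Suc k)) * (B * D k powr (q - 1))"
      proof (rule mult_mono)
        show "deriv \<phi> a \<le> deriv \<phi> (e (Suc k))" by (rule KL_desing_deriv_antimono[OF \<phi> pos a_ge aw])
        then show "0 \<le> deriv \<phi> (e (Suc k))" using \<phi>'pos by simp
        show "norm ?v \<le> B * D k powr (q - 1)"
          using xk Yk Pkb \<epsilon>(2) Dk(1) by (intro B(3)) auto
      qed simp
      finally have KL1: "1 \<le> deriv \<phi> (e (Suc k)) * (B * D k powr (q - 1))" .
      have e21: "0 \<le> e (Suc k) - e (Suc (Suc k))"
        using Phi_decseq by (simp add: e_def decseq_Suc_iff)
      have "c * D (Suc k) powr q \<le> (e (Suc k) - e (Suc (Suc k))) * 1" using drop by simp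
      also have "\<dots> \<le> (e (Suc k) - e (Suc (Suc k))) * (deriv \<phi> (e (Suc k)) * (B * D k powr (q - 1)))"
        using KL1 e21 by (rule mult_left_mono)
      also have "\<dots> = (deriv \<phi> (e (Suc k)) * (e (Suc k) - e (Suc (Suc k)))) * (B * D k powr (q - 1))"
        by (simp add: algebra_simps)
      also have "\<dots> \<le> (\<phi> (e (Suc k)) - \<phi> (e (Suc (Suc k)))) * (B * D k powr (q - 1))"
      proof (rule mult_right_mono)
        have "\<phi> (e (Suc (Suc k))) \<le> \<phi> (e (Suc k)) + deriv \<phi> (e (Suc k)) * (e (Suc (Suc k)) - e (Suc k))"
          using ew[OF k1] ew[OF k2] pos e_nonneg by (intro KL_desing_tangent[OF \<phi>]) auto
        then show "deriv \<phi> (e (Suc k)) * (e (Suc k) - e (Suc (Suc k))) \<le> \<phi> (e (Suc k)) - \<phi> (e (Suc (Suc k)))"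
          by (simp add: algebra_simps)
        show "0 \<le> B * D k powr (q - 1)" using B(2) by simp
      qed
      finally have main: "c * D (Suc k) powr q \<le> (\<phi> (e (Suc k)) - \<phi> (e (Suc (Suc k)))) * (B * D k powr (q - 1))" .
      have "0 \<le> deriv \<phi> (e (Suc k)) * (e (Suc k) - e (Suc (Suc k)))"
        using \<phi> pos ew[OF k1] e21 by (intro mult_nonneg_nonneg) (auto simp: KL_desing_def less_imp_le)
      also have "\<dots> \<le> \<phi> (e (Suc k)) - \<phi> (e (Suc (Suc k)))"
        using KL_desing_tangent[OF \<phi> pos ew[OF k1] e_nonneg ew[OF k2]] by (simp add: algebra_simps)
      finally show ?thesis
        by (intro powr_ratio_step[OF q D_nonneg D_nonneg c B(2) _ main])
    qed
  qed
  obtain A where A: "A \<ge> 0" "\<And>k. norm (x (Suc k) - x k) \<le> A * D k" using next_step_le by metis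
  show "summable D"
  proof (rule summable_of_local_recursion[where \<psi> = "\<lambda>k. \<phi> (e k)" and xb = xb, OF D_nonneg D_tendsto_0 _ _ A _ _ step])
    show "0 \<le> \<phi> (e k)" if "k \<ge> K0" for k using \<phi> e_nonneg ew[OF that] by (simp add: KL_desing_def)
    show "(\<lambda>k. \<phi> (e k)) \<longlonglongrightarrow> 0"
      using e_nonneg ew by (intro KL_desing_tendsto_0[OF \<phi> e_lim _ w]) (auto simp: eventually_sequentially)
    show "0 \<le> 4 * B / c" using B(2) c by simp
    show "0 < \<epsilon> / 2" using \<epsilon>(1) by simp
    show "\<exists>k\<ge>K. norm (x k - xb) < d" if "0 < d" for K d
    proof -
      have "eventually (\<lambda>n. dist (x (r n)) xb < d) sequentially" using r(2) that by (rule tendstoD)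
      moreover have "eventually (\<lambda>n. K \<le> n) sequentially" by (rule eventually_ge_at_top)
      ultimately have "eventually (\<lambda>n. dist (x (r n)) xb < d \<and> K \<le> n) sequentially" by eventually_elim simp
      then obtain n where n: "dist (x (r n)) xb < d" "K \<le> n" by (auto simp: eventually_sequentially)
      have "n \<le> r n" using r(1) by (rule strict_mono_imp_increasing)
      then show ?thesis using n by (intro exI[of _ "r n"]) (auto simp: dist_norm)
    qed
  qed
qed

lemma summable_and_convergent:
  assumes "KL_function (\<lambda>u. f u + g u)"
  shows "summable (\<lambda>k. norm (x (Suc k) - x k))" "\<exists>xb\<in>stationary (\<lambda>u. f u + g u). x \<longlonglongrightarrow> xb"
proof -
  obtain xb r where r: "strict_mono (r :: nat \<Rightarrow> nat)" "(\<lambda>n. x (r n)) \<longlonglongrightarrow> xb"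
    using bounded_imp_convergent_subsequence[OF bounded_x] unfolding o_def by metis
  have st: "xb \<in> stationary (\<lambda>u. f u + g u)" by (rule accumulation_point_stationary[OF r])
  then have "KL_at (\<lambda>u. f u + g u) xb" using assms unfolding KL_function_def stationary_def by blast
  then have D: "summable D" by (rule finite_length[OF r])
  obtain A where A: "\<And>k. norm (x (Suc k) - x k) \<le> A * D k" using next_step_le by metis
  show sum: "summable (\<lambda>k. norm (x (Suc k) - x k))"
    by (rule summable_comparison_test'[OF summable_mult[OF D, of A], of 0]) (simp add: A)
  then have "summable (\<lambda>k. x (Suc k) - x k)" by (rule summable_norm_cancel)
  then have "convergent (\<lambda>n. \<Sum>k<n. x (Suc k) - x k)" by (simp add: summable_iff_convergent)
  then have "convergent (\<lambda>n. x n - x 0)" by (simp add: sum_lessThan_telescope)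
  then obtain c where "(\<lambda>n. x n - x 0) \<longlonglongrightarrow> c" by (auto simp: convergent_def)
  from tendsto_add[OF this tendsto_const[of "x 0"]] have lim: "x \<longlonglongrightarrow> c + x 0" by simp
  then have "(\<lambda>n. x (r n)) \<longlonglongrightarrow> c + x 0" using LIMSEQ_subseq_LIMSEQ[OF _ r(1)] by (fastforce simp: o_def)
  then have "c + x 0 = xb" using r(2) by (rule LIMSEQ_unique)
  then show "\<exists>xb\<in>stationary (\<lambda>u. f u + g u). x \<longlonglongrightarrow> xb" using lim st by blast
qed

end

theorem theorem4p2:
  fixes f g :: "'a::euclidean_space \<Rightarrow> ereal"
    and U :: "'a set"
    and q Lm LM \<rho> \<sigma> \<tau> :: real
    and x :: "nat \<Rightarrow> 'a"
    and L :: "nat \<Rightarrow> nat \<Rightarrow> real"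
    and y :: "nat \<Rightarrow> nat \<Rightarrow> 'a"
    and J :: "nat \<Rightarrow> nat"
  assumes "2 \<le> q" "q \<le> 3"
    and "0 < Lm" "Lm < LM"
    and "0 < \<rho>" "\<rho> < 1"
    and "0 < \<sigma>" "\<sigma> < 1"
    and "1 < \<tau>"
    and "assumption_A1 f g U"
    and "algorithm_run f g q Lm LM \<rho> \<sigma> \<tau> x L y J"
    and "assumption_A2 f U x"
    and "KL_function (\<lambda>u. f u + g u)"
  shows "summable (\<lambda>k. norm (x (Suc k) - x k)) \<and>
         (\<exists>xb \<in> stationary (\<lambda>u. f u + g u). x \<longlonglongrightarrow> xb)"
proof -
  interpret regularized_newton_run f g U q Lm LM \<rho> \<sigma> \<tau> x L y J
    using assms by unfold_locales
  show ?thesis using summable_and_convergent[OF assms(13)] by blast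
qed

end
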